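(* Let $\nu$ be a positive integer, and let $N_k = n_k+n_{k+1}+\dots +n_{\nu}$, for $k=1,2,\dots, \nu$. Then, for a non-negative integer $L$, \begin{align*} \sum_{\substack{m,n_1,n_2,\dots,n_\nu\geq 0,\\L+m\equiv N_1+N_2+\dots + N_\nu \text{ (mod 2)}}} q^{m^2+3(N_1^2+N_2^2+\dots +N_\nu^2)} &{3n_\nu \brack m}_{q^2} {2n_\nu + \frac{L-m-N_1-N_2-\dots-N_\nu}{2}\brack 2n_\nu}_{q^6}\prod_{j=1}^{\nu-1} {L-\sum_{l=1}^j N_l +n_j \brack n_j}_{q^6}\\ &= \sum_{j=-\infty}^{\infty} q^{3(\nu+1)j^2 +2j}\, T_0 \left(L;\,(\nu+1)j;\,q^6 \right). \end{align*}
   Context: Here $|q|<1$, $(a;q)_n=(1-a)(1-aq)\cdots(1-aq^{n-1})$ (with $1/(q;q)_n=0$ for $n<0$), and ${m+n \brack m}_q = \frac{(q;q)_{m+n}}{(q;q)_m(q;q)_n}$ for $m,n\geq 0$ and $0$ otherwise. The Andrews–Baxter $q$-trinomial coefficients are \[\left(L,b;\,a;\,q\right)_2 := \sum_{n\geq 0 } q^{n(n+b)} \frac{(q;q)_L}{(q;q)_n(q;q)_{n+a}(q;q)_{L-2n-a}},\qquad T_0(L;\,a;\,q) := q^{\frac{L^2-a^2}{2}} \left(L,a;\,a;\,q^{-1}\right)_2 .\] *)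

theory Defs
  imports "HOL-Analysis.Analysis" "HOL-Number_Theory.Cong"
begin

definition qpoch :: "complex \<Rightarrow> complex \<Rightarrow> nat \<Rightarrow> complex" where
  "qpoch a q n = (\<Prod>k<n. 1 - a * q ^ k)"

text \<open>The reciprocal \<open>1 / (q;q)\<^sub>n\<close> for an integer index, with the convention that it is
  \<open>0\<close> for \<open>n < 0\<close>.\<close>

definition inv_qpoch :: "complex \<Rightarrow> int \<Rightarrow> complex" where
  "inv_qpoch q n = (if n < 0 then 0 else 1 / qpoch q q (nat n))"

text \<open>The first argument after the base is the top entry: \<open>qbinom q (m + n) m\<close> is the
  \<open>q\<close>-binomial coefficient \<open>(q;q)\<^sub>m\<^sub>+\<^sub>n / ((q;q)\<^sub>m (q;q)\<^sub>n)\<close> if \<open>m, n \<ge> 0\<close>, and \<open>0\<close> otherwise.\<close>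

definition qbinom :: "complex \<Rightarrow> int \<Rightarrow> int \<Rightarrow> complex" where
  "qbinom q a b =
     (if 0 \<le> b \<and> 0 \<le> a - b
      then qpoch q q (nat a) / (qpoch q q (nat b) * qpoch q q (nat (a - b)))
      else 0)"

text \<open>The Andrews--Baxter \<open>q\<close>-trinomial coefficient \<open>(L, b; a; q)\<^sub>2\<close>. Only the finitely many
  \<open>n\<close> with \<open>2 n \<le> L - a\<close> contribute.\<close>

definition qtrinom :: "nat \<Rightarrow> int \<Rightarrow> int \<Rightarrow> complex \<Rightarrow> complex" where
  "qtrinom L b a q =
     (\<Sum>\<^sub>\<infinity>n::nat. q powi (int n * (int n + b)) *
        (qpoch q q L * inv_qpoch q (int n) * inv_qpoch q (int n + a)
          * inv_qpoch q (int L - 2 * int n - a)))"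

text \<open>\<open>T\<^sub>0(L; a; q) = q\<^bsup>(L^2 - a^2)/2\<^esup> (L, a; a; 1/q)\<^sub>2\<close> involves a square root of the base \<open>q\<close>, on
  which it depends up to a sign. The argument \<open>s\<close> is this square root: \<open>T0 L a s\<close> is
  \<open>T\<^sub>0(L; a; s\<^sup>2)\<close> with \<open>(s\<^sup>2)\<^bsup>k/2\<^esup> = s\<^sup>k\<close>. In particular \<open>T\<^sub>0(L; a; q\<^sup>6)\<close>, whose prefactor is
  \<open>q\<^bsup>3 (L^2 - a^2)\<^esup>\<close>, is \<open>T0 L a (q\<^sup>3)\<close>. Using the principal branch of \<open>powr\<close> on \<open>q\<^sup>6\<close>
  would give the wrong sign for some complex \<open>q\<close>.\<close>

definition T0 :: "nat \<Rightarrow> int \<Rightarrow> complex \<Rightarrow> complex" where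
  "T0 L a s = s powi ((int L)\<^sup>2 - a\<^sup>2) * qtrinom L a a (inverse (s\<^sup>2))"

text \<open>\<open>N\<^sub>k = n\<^sub>k + n\<^sub>k\<^sub>+\<^sub>1 + \<dots> + n\<^sub>\<nu>\<close>\<close>

definition tail_sum :: "nat \<Rightarrow> (nat \<Rightarrow> nat) \<Rightarrow> nat \<Rightarrow> nat" where
  "tail_sum \<nu> n k = (\<Sum>i=k..\<nu>. n i)"

text \<open>The index set of the multiple sum. The tuple \<open>(n\<^sub>1, \<dots>, n\<^sub>\<nu>)\<close> is an extensional function
  on \<open>{1..\<nu>}\<close>.\<close>

definition sum_index :: "nat \<Rightarrow> nat \<Rightarrow> (nat \<times> (nat \<Rightarrow> nat)) set" where
  "sum_index \<nu> L =
     {(m, n). n \<in> {1..\<nu>} \<rightarrow>\<^sub>E UNIV \<and> [L + m = (\<Sum>k=1..\<nu>. tail_sum \<nu> n k)] (mod 2)}"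

text \<open>The next lemmas show that all infinite sums involved have finite support, so that the
  default value of \<open>infsum\<close> for non-summable families plays no role.\<close>

lemma qtrinom_finite_support:
  "finite {n::nat. inv_qpoch q (int L - 2 * int n - a) \<noteq> 0}"
  by (rule finite_subset[of _ "{..nat (int L - a)}"])
     (auto simp: inv_qpoch_def split: if_splits)

lemma T0_eq_0:
  assumes "int L < \<bar>a\<bar>"
  shows "T0 L a s = 0"
proof -
  have "inv_qpoch q (int n + a) * inv_qpoch q (int L - 2 * int n - a) = 0" for q and n :: nat
    using assms by (auto simp: inv_qpoch_def)
  then have "qtrinom L a a q = 0" for q
    unfolding qtrinom_def by (intro infsum_0) (auto simp: mult.assoc)
  then show ?thesis
    by (simp add: T0_def)
qed

lemma T0_finite_support:
  assumes "c \<noteq> 0"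
  shows "finite {j::int. T0 L (c * j) s \<noteq> 0}"
proof (rule finite_subset)
  show "{j. T0 L (c * j) s \<noteq> 0} \<subseteq> {- int L..int L}"
  proof
    fix j assume "j \<in> {j. T0 L (c * j) s \<noteq> 0}"
    then have "T0 L (c * j) s \<noteq> 0"
      by simp
    then have "\<not> int L < \<bar>c * j\<bar>"
      using T0_eq_0 by blast
    moreover have "1 * \<bar>j\<bar> \<le> \<bar>c\<bar> * \<bar>j\<bar>"
      using assms by (intro mult_right_mono) linarith+
    ultimately have "\<bar>j\<bar> \<le> int L"
      unfolding abs_mult by linarith
    then show "j \<in> {- int L..int L}"
      unfolding atLeastAtMost_iff by linarith
  qed
qed (rule finite_atLeastAtMost_int)

lemma multisum_finite_support:
  "finite {(m, n) \<in> sum_index \<nu> L.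
     qbinom q (2 * int (n \<nu>)
       + (int L - int m - int (\<Sum>k=1..\<nu>. tail_sum \<nu> n k)) div 2) (2 * int (n \<nu>)) \<noteq> 0}"
  (is "finite ?S")
proof (rule finite_subset)
  show "?S \<subseteq> {..L} \<times> ({1..\<nu>} \<rightarrow>\<^sub>E {..L})"
  proof (rule subrelI)
    fix m n
    assume "(m, n) \<in> ?S"
    then have idx: "(m, n) \<in> sum_index \<nu> L"
      and nz: "qbinom q (2 * int (n \<nu>)
       + (int L - int m - int (\<Sum>k=1..\<nu>. tail_sum \<nu> n k)) div 2) (2 * int (n \<nu>)) \<noteq> 0"
      by blast+
    have "0 \<le> (int L - int m - int (\<Sum>k=1..\<nu>. tail_sum \<nu> n k)) div 2"
      using nz unfolding qbinom_def by (metis add_diff_cancel_left')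
    then have "0 \<le> int L - int m - int (\<Sum>k=1..\<nu>. tail_sum \<nu> n k)"
      by (simp only: pos_imp_zdiv_nonneg_iff zero_less_numeral)
    then have le: "m + (\<Sum>k=1..\<nu>. tail_sum \<nu> n k) \<le> L"
      by linarith
    have "n i \<le> L" if "i \<in> {1..\<nu>}" for i
    proof -
      have "n i \<le> tail_sum \<nu> n i"
        unfolding tail_sum_def using that by (intro member_le_sum) auto
      also have "\<dots> \<le> (\<Sum>k=1..\<nu>. tail_sum \<nu> n k)"
        using that by (intro member_le_sum) auto
      finally show ?thesis using le by linarith
    qed
    moreover have "n \<in> extensional {1..\<nu>}"
      using idx by (simp add: sum_index_def PiE_def)
    ultimately have "n \<in> {1..\<nu>} \<rightarrow>\<^sub>E {..L}"
      by (simp add: PiE_iff)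
    then show "(m, n) \<in> {..L} \<times> ({1..\<nu>} \<rightarrow>\<^sub>E {..L})"
      using le by simp
  qed
qed (intro finite_cartesian_product finite_PiE finite_atMost finite_atLeastAtMost)

end

theory Submission
  imports Defs "HOL-Computational_Algebra.Polynomial"
begin

text \<open>A Burge transformation of the refined \<open>q\<close>-trinomials \<open>T(L, M; a, b)\<close> replaces \<open>a\<close> by
  \<open>a + b\<close> at the cost of one summation. Each \<open>N\<^sub>k\<close> in the multiple sum is one such step, and \<open>N\<^sub>1\<close>
  is the step in its limit \<open>M \<rightarrow> \<infinity>\<close>, where \<open>T\<close> degenerates to \<open>T\<^sub>0\<close>. The chain starts from the
  sum of \<open>q\<^bsup>3j^2 + 2j\<^esup> T(L, M; j, j)\<close> over \<open>j\<close>, which is computed from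
  \<open>(-zq; q\<^sup>2)\<^sub>3\<^sub>M = (-zq; q\<^sup>6)\<^sub>M (-zq\<^sup>3; q\<^sup>6)\<^sub>M (-zq\<^sup>5; q\<^sup>6)\<^sub>M\<close>. Both the transformation and the start
  rest on the \<open>q\<close>-Pfaff--Saalschuetz sum.\<close>

subsection \<open>\<open>q\<close>-binomial coefficients\<close>

text \<open>The second parameter M is what makes iteration possible: a step at (L, M) sums over
  values at (L - i, i), so i is the M of the next inner step. Each step multiplies by q^(3 b^2) and
  leaves b unchanged. From a = b = |j|, \<nu> steps therefore reach a = (\<nu> + 1) |j| and add 3
  \<nu> j^2 to the initial exponent 3 j^2 + 2 j, which accounts for both factors \<nu> + 1 in the
  result. Two mismatches shape the details. The index j takes both signs, but a step needs b \<ge>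
  0; so the chain runs with |j|, and the symmetry in j at its start and at its end restores the sum
  over j. And \<open>qbinom\<close> is 0 for negative top entries, whereas the Pascal rules hold
  without exception only for the product form. The two have to be reconciled whenever a result is
  carried over to the theorem.\<close>

text \<open>Unlike in \<open>qbinom\<close>, the top entry \<open>y\<close> may be negative, where the value need not vanish.
  The induction for the Burge transformation needs this.\<close>

definition gqbinom :: "complex \<Rightarrow> int \<Rightarrow> int \<Rightarrow> complex" where
  "gqbinom q y t =
     (if t < 0 then 0
      else (\<Prod>r<nat t. 1 - q powi (y - int r)) / (\<Prod>r<nat t. 1 - q ^ Suc r))"

text \<open>Ring form of a Pascal rule: X, Y, Z stand for q^t, q^(y+1-t), q^(y+1), and A, B, U for
  \<open>gb y t\<close>, \<open>gb y (t - 1)\<close>, \<open>gb (y + 1) t\<close>. Keeping 1 - X as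
  a factor avoids division.\<close>

lemma pascal_algebra1:
  fixes X :: complex
  assumes "Y * X = Z" "A * (1 - X) = B * (1 - Y)" "U * (1 - X) = B * (1 - Z)"
  shows "U * (1 - X) = (A + Y * B) * (1 - X)"
proof -
  have "(A + Y * B) * (1 - X) = A * (1 - X) + Y * B - (Y * X) * B" by (simp add: algebra_simps)
  also have "\<dots> = U * (1 - X)" unfolding assms by (simp add: algebra_simps)
  finally show ?thesis ..
qed

lemma pascal_algebra2:
  fixes X :: complex
  assumes "Y * X = Z" "A * (1 - X) = B * (1 - Y)" "U * (1 - X) = B * (1 - Z)"
  shows "U * (1 - X) = (X * A + B) * (1 - X)"
proof -
  have "(X * A + B) * (1 - X) = X * (A * (1 - X)) + B - X * B" by (simp add: algebra_simps)
  also have "\<dots> = U * (1 - X)" unfolding assms(2,3) assms(1)[symmetric] by (simp add: algebra_simps)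
  finally show ?thesis ..
qed

lemma ratio_algebra:
  fixes X :: complex
  assumes "U * X = B * Z" "A * X = B * W" "X \<noteq> 0"
  shows "U * W = A * Z"
proof -
  have "(U * W) * X = (U * X) * W" by (simp only: mult_ac)
  also have "\<dots> = (B * W) * Z" unfolding assms(1) by (simp only: mult_ac)
  also have "\<dots> = (A * Z) * X" unfolding assms(2)[symmetric] by (simp only: mult_ac)
  finally show ?thesis using assms(3) by simp
qed

lemma revision_algebra:
  fixes X :: complex
  assumes "H' * X = H * K" "R' * Z = R * K" "S' * X = S * Z" "G * H = R * S" "X \<noteq> 0" "Z \<noteq> 0"
  shows "G * H' = R' * S'"
proof -
  have "(G * H') * (X * Z) = G * (H' * X) * Z" by (simp only: mult_ac)
  also have "\<dots> = (G * H) * K * Z" unfolding assms(1) by (simp only: mult_ac)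
  also have "\<dots> = (R * K) * (S * Z)" unfolding assms(4) by (simp only: mult_ac)
  also have "\<dots> = (R' * S') * (X * Z)" unfolding assms(2,3)[symmetric] by (simp only: mult_ac)
  finally show ?thesis using assms(5,6) by simp
qed

text \<open>The coefficients occur in the two bases q^2 and q^6, so their theory is set up for a
  general base and instantiated twice.\<close>

locale non_root =
  fixes q :: complex
  assumes q_nz: "q \<noteq> 0" and not_root: "q ^ Suc r \<noteq> 1"
begin

abbreviation gb :: "int \<Rightarrow> int \<Rightarrow> complex" where "gb \<equiv> gqbinom q"

lemma powi_ne_1:
  assumes "(t::int) > 0"
  shows "1 - q powi t \<noteq> 0"
proof -
  obtain r where "t = int (Suc r)"
    using assms by (metis Suc_pred' zero_less_imp_eq_int)
  then have "q powi t = q ^ Suc r" by (simp only: power_int_of_nat)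
  then show ?thesis using not_root[of r] by simp
qed

section \<open>One-step recurrences, Pascal rules and trinomial revision\<close>

lemma gb_neg [simp]: "t < 0 \<Longrightarrow> gb y t = 0"
  by (simp add: gqbinom_def)

lemma gb_0 [simp]: "gb y 0 = 1"
  by (simp add: gqbinom_def)

text \<open>With a top entry of any sign there is no quotient of factorials to compute with. This
  recurrence and \<open>gb_rec_both\<close> take its place.\<close>

lemma gb_rec_lower:
  assumes "t \<ge> 0"
  shows "gb y (t + 1) * (1 - q powi (t + 1)) = gb y t * (1 - q powi (y - t))"
proof -
  obtain n where t: "t = int n" using assms nonneg_int_cases by blast
  have n1: "nat (int n + 1) = Suc n" by simp
  have "q powi (int n + 1) = q ^ Suc n"
    by (metis of_nat_Suc add.commute power_int_of_nat)
  then show ?thesis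
    using not_root[of n] unfolding t gqbinom_def n1 by (simp add: divide_simps)
qed

lemma gb_rec_both:
  assumes "t \<ge> 0"
  shows "gb (y + 1) (t + 1) * (1 - q powi (t + 1)) = gb y t * (1 - q powi (y + 1))"
proof -
  obtain n where t: "t = int n" using assms nonneg_int_cases by blast
  have n1: "nat (int n + 1) = Suc n" by simp
  have p: "q powi (int n + 1) = q ^ Suc n"
    by (metis of_nat_Suc add.commute power_int_of_nat)
  have "(\<Prod>r<Suc n. 1 - q powi (y + 1 - int r)) =
        (1 - q powi (y + 1)) * (\<Prod>r<n. 1 - q powi (y - int r))"
    by (subst prod.lessThan_Suc_shift) (simp add: algebra_simps)
  then show ?thesis
    using not_root[of n] unfolding t gqbinom_def n1 p by (simp add: divide_simps)
qed

lemma pascal1: "gb (y + 1) t = gb y t + q powi (y + 1 - t) * gb y (t - 1)"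
proof (cases "t \<ge> 1")
  case True
  have nz: "1 - q powi t \<noteq> 0" using True by (intro powi_ne_1) simp
  have lo: "gb y t * (1 - q powi t) = gb y (t - 1) * (1 - q powi (y + 1 - t))"
    using gb_rec_lower[of "t - 1" y] True by (simp add: algebra_simps)
  have bo: "gb (y + 1) t * (1 - q powi t) = gb y (t - 1) * (1 - q powi (y + 1))"
    using gb_rec_both[of "t - 1" y] True by simp
  have "q powi (y + 1 - t) * q powi t = q powi (y + 1)"
    using q_nz by (simp flip: power_int_add)
  then have "gb (y + 1) t * (1 - q powi t) = (gb y t + q powi (y + 1 - t) * gb y (t - 1)) * (1 - q powi t)"
    using lo bo by (rule pascal_algebra1)
  with nz show ?thesis by simp
next
  case False
  then show ?thesis by (cases "t = 0") auto
qed

lemma pascal2: "gb (y + 1) t = q powi t * gb y t + gb y (t - 1)"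
proof (cases "t \<ge> 1")
  case True
  have nz: "1 - q powi t \<noteq> 0" using True by (intro powi_ne_1) simp
  have lo: "gb y t * (1 - q powi t) = gb y (t - 1) * (1 - q powi (y + 1 - t))"
    using gb_rec_lower[of "t - 1" y] True by (simp add: algebra_simps)
  have bo: "gb (y + 1) t * (1 - q powi t) = gb y (t - 1) * (1 - q powi (y + 1))"
    using gb_rec_both[of "t - 1" y] True by simp
  have "q powi (y + 1 - t) * q powi t = q powi (y + 1)"
    using q_nz by (simp flip: power_int_add)
  then have "gb (y + 1) t * (1 - q powi t) = (q powi t * gb y t + gb y (t - 1)) * (1 - q powi t)"
    using lo bo by (rule pascal_algebra2)
  with nz show ?thesis by simp
next
  case False
  then show ?thesis by (cases "t = 0") auto
qed

lemma gb_eq_0: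
  assumes "0 \<le> y" "y < t"
  shows "gb y t = 0"
proof -
  have "(\<Prod>r<nat t. 1 - q powi (y - int r)) = 0"
    using assms by (intro prod_zero) (auto intro!: bexI[of _ "nat y"])
  then show ?thesis by (simp add: gqbinom_def)
qed

lemma gb_self: "m \<ge> 0 \<Longrightarrow> gb m m = 1"
proof (induction m rule: int_ge_induct)
  case (step i)
  then show ?case using pascal2[of i "i + 1"] gb_eq_0[of i "i + 1"] by simp
qed simp

text \<open>For nonnegative m and n, raising n by 1 changes both sides by the same factor:
  \<open>gb (y - m) n\<close> and \<open>gb y (m + n)\<close> gain the same numerator 1 - q^(y-m-n),
  whatever the sign of y.\<close>

lemma gb_trinomial_revision: "gb y m * gb (y - m) n = gb y (m + n) * gb (m + n) m"
proof (cases "m \<ge> 0 \<and> n \<ge> 0")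
  case True
  then have "n \<ge> 0" "m \<ge> 0" by auto
  then show ?thesis
  proof (induction n rule: int_ge_induct)
    case base
    then show ?case using gb_self[of m] by simp
  next
    case (step n)
    have e1: "gb (y - m) (n + 1) * (1 - q powi (n + 1)) = gb (y - m) n * (1 - q powi (y - m - n))"
      using gb_rec_lower[of n "y - m"] step by simp
    have e2: "gb y (m + n + 1) * (1 - q powi (m + n + 1)) = gb y (m + n) * (1 - q powi (y - m - n))"
      using gb_rec_lower[of "m + n" y] step by (simp add: diff_diff_eq)
    have e3: "gb (m + n + 1) m * (1 - q powi (n + 1)) = gb (m + n) m * (1 - q powi (m + n + 1))"
    proof (cases "m = 0")
      case False
      have "gb (m + n + 1) m * (1 - q powi m) = gb (m + n) (m - 1) * (1 - q powi (m + n + 1))"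
        using gb_rec_both[of "m - 1" "m + n"] False step by simp
      moreover have "gb (m + n) m * (1 - q powi m) = gb (m + n) (m - 1) * (1 - q powi (n + 1))"
        using gb_rec_lower[of "m - 1" "m + n"] False step by simp
      moreover have "1 - q powi m \<noteq> 0" using False step by (intro powi_ne_1) auto
      ultimately show ?thesis by (rule ratio_algebra)
    qed simp
    have "gb y m * gb (y - m) n = gb y (m + n) * gb (m + n) m" using step by simp
    from revision_algebra[OF e1 e2 e3 this powi_ne_1 powi_ne_1]
    show ?case using step by (simp add: add.assoc)
  qed
next
  case False
  then show ?thesis
  proof (cases "m < 0")
    case False
    with \<open>\<not> (m \<ge> 0 \<and> n \<ge> 0)\<close> have "n < 0" "m \<ge> 0" by auto
    \<comment> \<open>The left side is 0 as n < 0. On the right either the lower entry m + n is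
      negative, or 0 \<le> m + n < m and the second factor vanishes.\<close>
    then show ?thesis by (cases "m + n < 0") (auto simp: gb_eq_0)
  qed auto
qed

section \<open>Comparison with q-factorials\<close>

lemma qpoch_nz: "qpoch q q n \<noteq> 0"
  using not_root by (simp add: qpoch_def)

lemma gb_qpoch: "gb (int (m + n)) (int m) * (qpoch q q m * qpoch q q n) = qpoch q q (m + n)"
proof (induction m)
  case 0
  then show ?case by (simp add: qpoch_def)
next
  case (Suc m)
  have p: "q powi (int k + 1) = q ^ Suc k" for k
    using power_int_of_nat[of q "Suc k"] by (simp only: of_nat_Suc add.commute)
  have S: "qpoch q q (Suc k) = qpoch q q k * (1 - q ^ Suc k)" for k
    by (simp add: qpoch_def)
  have "gb (int (m + n) + 1) (int m + 1) * (1 - q ^ Suc m) =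
      gb (int (m + n)) (int m) * (1 - q ^ Suc (m + n))"
    using gb_rec_both[of "int m" "int (m + n)"] unfolding p by simp
  then have "gb (int (Suc m + n)) (int (Suc m)) * (qpoch q q (Suc m) * qpoch q q n)
     = (gb (int (m + n)) (int m) * (qpoch q q m * qpoch q q n)) * (1 - q ^ Suc (m + n))"
    unfolding S by (simp only: of_nat_Suc of_nat_add add_Suc mult_ac add_ac)
  also have "\<dots> = qpoch q q (Suc m + n)"
    unfolding Suc by (simp only: S add_Suc)
  finally show ?case .
qed

lemma gb_eq_qbinom:
  assumes "y \<ge> 0"
  shows "gb y t = qbinom q y t"
proof (cases "0 \<le> t \<and> t \<le> y")
  case True
  define m n where "m = nat t" and "n = nat (y - t)"
  have "y = int (m + n)" "t = int m" using True by (auto simp: m_def n_def)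
  then show ?thesis
    using gb_qpoch[of m n] qpoch_nz[of m] qpoch_nz[of n]
    by (simp add: qbinom_def field_simps nat_add_distrib)
next
  case False
  then show ?thesis using assms by (auto simp: qbinom_def gb_eq_0)
qed

text \<open>Restricted to nonnegative top entries: for m < 0 and t = 0 the left side is 0 and the
  right side is 1.\<close>

lemma gb_sym: "m \<ge> 0 \<Longrightarrow> gb m (m - t) = gb m t"
  by (simp add: gb_eq_qbinom qbinom_def mult.commute)

text \<open>One Pascal rule splits the top entry y + 1 in the induction hypothesis; after a shift of
  t in one half, the other rule merges the halves into top entry m + 1.\<close>

lemma gb_vandermonde_aux:
  "gb (y + int m) k = (\<Sum>t\<in>{0..int m}. gb (int m) t * gb y (k - t) * q powi ((int m - t) * (k - t)))"
proof (induction m arbitrary: y)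
  case 0
  then show ?case by simp
next
  case (Suc m)
  let ?m = "int m"
  have "gb (y + int (Suc m)) k = gb ((y + 1) + ?m) k" by (simp add: algebra_simps)
  also have "\<dots> = (\<Sum>t\<in>{0..?m}. gb ?m t * gb (y + 1) (k - t) * q powi ((?m - t) * (k - t)))"
    by (rule Suc)
  also have "\<dots> = (\<Sum>t\<in>{0..?m}. gb ?m t * gb y (k - t) * q powi ((?m + 1 - t) * (k - t))) +
       (\<Sum>t\<in>{0..?m}. gb ?m t * gb y (k - t - 1) * q powi ((?m - t) * (k - t)))"
  proof -
    have "gb ?m t * gb (y + 1) (k - t) * q powi ((?m - t) * (k - t)) =
        gb ?m t * gb y (k - t) * q powi ((?m + 1 - t) * (k - t)) +
        gb ?m t * gb y (k - t - 1) * q powi ((?m - t) * (k - t))" for t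
    proof -
      have e: "q powi ((?m + 1 - t) * (k - t)) = q powi (k - t) * q powi ((?m - t) * (k - t))"
        using q_nz by (simp flip: power_int_add add: algebra_simps)
      show ?thesis unfolding pascal2 e by (simp add: distrib_left distrib_right mult_ac)
    qed
    then show ?thesis by (simp add: sum.distrib)
  qed
  also have "(\<Sum>t\<in>{0..?m}. gb ?m t * gb y (k - t) * q powi ((?m + 1 - t) * (k - t)))
      = (\<Sum>t\<in>{0..?m+1}. gb ?m t * gb y (k - t) * q powi ((?m + 1 - t) * (k - t)))"
    by (intro sum.mono_neutral_left) (auto simp: gb_eq_0)
  also have "(\<Sum>t\<in>{0..?m}. gb ?m t * gb y (k - t - 1) * q powi ((?m - t) * (k - t)))
      = (\<Sum>t\<in>{1..?m+1}. gb ?m (t - 1) * gb y (k - t) * q powi ((?m + 1 - t) * (k - t + 1)))"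
    by (rule sum.reindex_bij_witness[of _ "\<lambda>t. t - 1" "\<lambda>t. t + 1"]) (auto simp: algebra_simps)
  also have "\<dots> = (\<Sum>t\<in>{0..?m+1}. gb ?m (t - 1) * gb y (k - t) * q powi ((?m + 1 - t) * (k - t + 1)))"
  proof (intro sum.mono_neutral_left ballI)
    fix t assume "t \<in> {0..?m+1} - {1..?m+1}"
    then have "t = 0" by auto
    then show "gb ?m (t - 1) * gb y (k - t) * q powi ((?m + 1 - t) * (k - t + 1)) = 0" by simp
  qed auto
  also have "(\<Sum>t\<in>{0..?m+1}. gb ?m t * gb y (k - t) * q powi ((?m + 1 - t) * (k - t))) + \<dots>
      = (\<Sum>t\<in>{0..?m+1}. gb (?m + 1) t * gb y (k - t) * q powi ((?m + 1 - t) * (k - t)))"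
  proof -
    have "gb ?m t * gb y (k - t) * q powi ((?m + 1 - t) * (k - t)) +
        gb ?m (t - 1) * gb y (k - t) * q powi ((?m + 1 - t) * (k - t + 1)) =
        gb (?m + 1) t * gb y (k - t) * q powi ((?m + 1 - t) * (k - t))" for t
    proof -
      have e: "q powi ((?m + 1 - t) * (k - t + 1)) = q powi (?m + 1 - t) * q powi ((?m + 1 - t) * (k - t))"
        using q_nz by (simp flip: power_int_add add: algebra_simps)
      show ?thesis unfolding pascal1 e by (simp add: distrib_left distrib_right mult_ac)
    qed
    then show ?thesis by (simp flip: sum.distrib)
  qed
  finally show ?case by (simp add: add.commute)
qed

text \<open>Indexed by the part j taken from y, over any finite J that covers the nonzero terms,
  since the applications come with different ranges.\<close>

lemma gb_vandermonde:
  assumes "m \<ge> 0" "finite J" and J: "\<And>j. 0 \<le> j \<Longrightarrow> j \<le> k \<Longrightarrow> k - j \<le> m \<Longrightarrow> j \<in> J"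
  shows "gb (m + y) k = (\<Sum>j\<in>J. gb m (k - j) * gb y j * q powi (j * (m - k + j)))"
proof -
  obtain n where m: "m = int n" using assms(1) nonneg_int_cases by blast
  have "gb (m + y) k = (\<Sum>t\<in>{0..m}. gb m t * gb y (k - t) * q powi ((m - t) * (k - t)))"
    using gb_vandermonde_aux[of y n k] by (simp add: m add.commute)
  also have "\<dots> = (\<Sum>j\<in>{k-m..k}. gb m (k - j) * gb y j * q powi (j * (m - k + j)))"
    by (rule sum.reindex_bij_witness[of _ "\<lambda>t. k - t" "\<lambda>t. k - t"]) (auto simp: algebra_simps)
  also have "\<dots> = (\<Sum>j\<in>{k-m..k} \<inter> J. gb m (k - j) * gb y j * q powi (j * (m - k + j)))"
  proof (intro sum.mono_neutral_right ballI)
    fix j assume "j \<in> {k-m..k} - {k-m..k} \<inter> J"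
    then have "j < 0" using J[of j] by force
    then show "gb m (k - j) * gb y j * q powi (j * (m - k + j)) = 0" by simp
  qed auto
  also have "\<dots> = (\<Sum>j\<in>J. gb m (k - j) * gb y j * q powi (j * (m - k + j)))"
  proof (intro sum.mono_neutral_left ballI)
    fix j assume "j \<in> J - {k-m..k} \<inter> J"
    then have "k - j > m \<or> k - j < 0" by auto
    then show "gb m (k - j) * gb y j * q powi (j * (m - k + j)) = 0"
      using assms(1) by (auto simp: gb_eq_0)
  qed (use assms in auto)
  finally show ?thesis .
qed

text \<open>Apply Vandermonde to \<open>gb ((x - \<beta> + k) + (y + \<beta>)) k\<close>, sum over \<open>k\<close> by Vandermonde, and sum the
  rest by Vandermonde once more.\<close>

lemma gb_saalschutz:
  assumes "x \<ge> 0"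
  shows "(\<Sum>k\<in>{0..\<beta>}. q powi ((\<alpha> - k) * (\<beta> - k)) * gb (x + y + k) k * gb y (\<alpha> - k) * gb x (\<beta> - k))
       = gb (x + \<alpha>) \<beta> * gb (y + \<beta>) \<alpha>"
proof (cases "\<alpha> \<ge> 0")
  case False
  then show ?thesis by (simp add: sum.neutral)
next
  case al: True
  let ?I = "{0..\<beta>}"
  have "(\<Sum>k\<in>?I. q powi ((\<alpha> - k) * (\<beta> - k)) * gb (x + y + k) k * gb y (\<alpha> - k) * gb x (\<beta> - k))
      = (\<Sum>k\<in>?I. \<Sum>j\<in>?I. q powi ((\<alpha> - k) * (\<beta> - k)) * q powi (j * (x - \<beta> + j)) * gb y (\<alpha> - k) *
           gb x (\<beta> - j) * gb (\<beta> - j) (k - j) * gb (y + \<beta>) j)"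
  proof (rule sum.cong)
    fix k assume k: "k \<in> ?I"
    show "q powi ((\<alpha> - k) * (\<beta> - k)) * gb (x + y + k) k * gb y (\<alpha> - k) * gb x (\<beta> - k)
      = (\<Sum>j\<in>?I. q powi ((\<alpha> - k) * (\<beta> - k)) * q powi (j * (x - \<beta> + j)) * gb y (\<alpha> - k) *
           gb x (\<beta> - j) * gb (\<beta> - j) (k - j) * gb (y + \<beta>) j)"
    \<comment> \<open>If \<beta> - k > x, then x - \<beta> + k is negative and cannot serve as the
      nonnegative part in Vandermonde, but both sides vanish: for j \<le> k because of
      \<open>gb x (\<beta> - j)\<close>, for j > k because k - j is negative.\<close>
    proof (cases "\<beta> - k \<le> x")
      case True
      let ?m = "x - \<beta> + k"
      have V: "gb (x + y + k) k = (\<Sum>j\<in>?I. gb ?m (k - j) * gb (y + \<beta>) j * q powi (j * (x - \<beta> + j)))"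
        using gb_vandermonde[of ?m ?I k "y + \<beta>"] True k by (simp add: algebra_simps)
      have R: "gb x (\<beta> - j) * gb (\<beta> - j) (k - j) = gb x (\<beta> - k) * gb ?m (k - j)" if "j \<in> ?I" for j
      proof -
        have "gb (\<beta> - j) (\<beta> - j - (k - j)) = gb (\<beta> - j) (k - j)"
          using that by (intro gb_sym) auto
        moreover have "x - (\<beta> - k) = ?m" by simp
        ultimately show ?thesis
          using gb_trinomial_revision[of x "\<beta> - k" "k - j"] by (simp add: algebra_simps)
      qed
      show ?thesis unfolding V sum_distrib_left sum_distrib_right
      proof (rule sum.cong)
        fix j assume "j \<in> ?I"
        from R[OF this] show "q powi ((\<alpha> - k) * (\<beta> - k)) * (gb ?m (k - j) * gb (y + \<beta>) j * q powi (j * (x - \<beta> + j))) *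
           gb y (\<alpha> - k) * gb x (\<beta> - k) = q powi ((\<alpha> - k) * (\<beta> - k)) * q powi (j * (x - \<beta> + j)) * gb y (\<alpha> - k) *
           gb x (\<beta> - j) * gb (\<beta> - j) (k - j) * gb (y + \<beta>) j"
          by (simp add: mult_ac)
      qed simp
    next
      case False
      have "gb x (\<beta> - j) * gb (\<beta> - j) (k - j) = 0" if "j \<in> ?I" for j
        using False assms that by (cases "j \<le> k") (auto simp: gb_eq_0)
      moreover have "gb x (\<beta> - k) = 0" using False assms by (simp add: gb_eq_0)
      ultimately show ?thesis by (auto intro!: sum.neutral)
    qed
  qed simp
  also have "\<dots> = (\<Sum>j\<in>?I. q powi (j * (x - \<beta> + j)) * gb x (\<beta> - j) * gb (y + \<beta>) j *
       (\<Sum>k\<in>?I. gb (\<beta> - j) (k - j) * gb y (\<alpha> - k) * q powi ((\<alpha> - k) * (\<beta> - k))))"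
    unfolding sum_distrib_left by (subst sum.swap) (simp add: mult_ac)
  also have "\<dots> = (\<Sum>j\<in>?I. q powi (j * (x - \<beta> + j)) * gb x (\<beta> - j) * gb (y + \<beta>) j * gb (y + \<beta> - j) (\<alpha> - j))"
  proof (rule sum.cong)
    fix j assume j: "j \<in> ?I"
    have "gb (\<beta> - j + y) (\<alpha> - j) = (\<Sum>i\<in>{\<alpha>-\<beta>..\<alpha>}. gb (\<beta> - j) (\<alpha> - j - i) * gb y i * q powi (i * (\<beta> - j - (\<alpha> - j) + i)))"
      using j by (intro gb_vandermonde) auto
    also have "\<dots> = (\<Sum>k\<in>?I. gb (\<beta> - j) (k - j) * gb y (\<alpha> - k) * q powi ((\<alpha> - k) * (\<beta> - k)))"
      by (rule sum.reindex_bij_witness[of _ "\<lambda>k. \<alpha> - k" "\<lambda>k. \<alpha> - k"]) (auto simp: algebra_simps)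
    finally show "q powi (j * (x - \<beta> + j)) * gb x (\<beta> - j) * gb (y + \<beta>) j *
       (\<Sum>k\<in>?I. gb (\<beta> - j) (k - j) * gb y (\<alpha> - k) * q powi ((\<alpha> - k) * (\<beta> - k)))
       = q powi (j * (x - \<beta> + j)) * gb x (\<beta> - j) * gb (y + \<beta>) j * gb (y + \<beta> - j) (\<alpha> - j)"
      by (simp add: algebra_simps)
  qed simp
  \<comment> \<open>Trinomial revision turns the last two factors into
    \<open>gb (y + \<beta>) \<alpha> * gb \<alpha> j\<close>, which leaves a Vandermonde sum for the
    top entry x + \<alpha>.\<close>
  also have "\<dots> = (\<Sum>j\<in>?I. gb x (\<beta> - j) * gb \<alpha> j * q powi (j * (x - \<beta> + j))) * gb (y + \<beta>) \<alpha>"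
    unfolding sum_distrib_right
  proof (rule sum.cong)
    fix j
    show "q powi (j * (x - \<beta> + j)) * gb x (\<beta> - j) * gb (y + \<beta>) j * gb (y + \<beta> - j) (\<alpha> - j)
       = gb x (\<beta> - j) * gb \<alpha> j * q powi (j * (x - \<beta> + j)) * gb (y + \<beta>) \<alpha>"
      using gb_trinomial_revision[of "y + \<beta>" j "\<alpha> - j"] by (simp add: mult_ac)
  qed simp
  also have "(\<Sum>j\<in>?I. gb x (\<beta> - j) * gb \<alpha> j * q powi (j * (x - \<beta> + j))) = gb (x + \<alpha>) \<beta>"
    using assms by (intro gb_vandermonde[symmetric]) auto
  finally show ?thesis .
qed

end

subsection \<open>The Burge transformation\<close>

text \<open>The refined \<open>q\<close>-trinomial with base \<open>s\<^sup>2\<close>. It is usually written as a sum over \<open>n = L - a - 2 w\<close>;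
  summing over \<open>w\<close> builds in the condition \<open>n \<equiv> L - a (mod 2)\<close> and discards \<open>w < 0\<close>, but for
  \<open>a < 0\<close> it keeps terms whose last factor has a negative top entry.\<close>

definition rtrinom :: "complex \<Rightarrow> int \<Rightarrow> int \<Rightarrow> int \<Rightarrow> int \<Rightarrow> complex" where
  "rtrinom s L M a b =
     (\<Sum>w\<in>{0..L-a}. s powi (L - a - 2 * w)\<^sup>2 * gqbinom (s\<^sup>2) M (L - a - 2 * w)
        * gqbinom (s\<^sup>2) (w + M + b) (M + b) * gqbinom (s\<^sup>2) (w + a + M - b) (M - b))"

locale sqrt_base =
  fixes s :: complex
  assumes s_nz: "s \<noteq> 0" and norm_s: "norm s < 1"
begin

sublocale non_root "s\<^sup>2"
proof
  show "s\<^sup>2 \<noteq> 0" using s_nz by simp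
  fix r
  have "norm ((s\<^sup>2) ^ Suc r) < 1"
    using norm_s power_less_one_iff[of "norm s" "2 * Suc r"]
    by (simp only: norm_power power_mult[symmetric]) auto
  then show "(s\<^sup>2) ^ Suc r \<noteq> 1" by (metis less_irrefl norm_one)
qed

abbreviation RT :: "int \<Rightarrow> int \<Rightarrow> int \<Rightarrow> int \<Rightarrow> complex" where "RT \<equiv> rtrinom s"

lemma square_powi: "(s\<^sup>2) powi k = s powi (2 * k)"
  by (simp add: power_int_mult)

lemma RT_eq_0: "M < b \<Longrightarrow> RT L M a b = 0"
  by (simp add: rtrinom_def)

lemma RT_eq_0': "L < a \<Longrightarrow> RT L M a b = 0"
  by (simp add: rtrinom_def)

text \<open>For fixed i and \<sigma> in \<open>gb_triple_product\<close>, the sum over w is again a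
  refined trinomial: reflect the lower entry of \<open>gb \<sigma> _\<close> and shift w by b -
  \<sigma>. The squares in the exponent then recombine.\<close>

lemma RT_inner:
  assumes "b \<ge> 0" "0 \<le> \<sigma>" "\<sigma> \<le> i"
  shows "(\<Sum>w\<in>{0..L-a-b}. s powi (b\<^sup>2 + (L-a-b-2*w)\<^sup>2 + 2 * (\<sigma>\<^sup>2 - b\<^sup>2) + 2 * ((i-\<sigma>)*(i-(L-a-b-2*w))))
            * gb \<sigma> (i - (L-a-b-2*w)) * gb (w + a - b) (\<sigma> - b) * gb (w + 2 * b) (\<sigma> + b))
       = s powi (i\<^sup>2 - b\<^sup>2) * (s powi \<sigma>\<^sup>2 * RT (L - i - \<sigma>) \<sigma> (a - b) b)" (is "sum ?f _ = _")
proof (cases "\<sigma> \<ge> b")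
  case False
  then show ?thesis by (simp add: RT_eq_0)
next
  case sb: True
  let ?A = "{w \<in> {0..L-a-b}. ?f w \<noteq> 0}"
  let ?g = "\<lambda>w. s powi (i\<^sup>2 - b\<^sup>2) * (s powi \<sigma>\<^sup>2 * (s powi (L - i - \<sigma> - (a - b) - 2 * w)\<^sup>2 * gb \<sigma> (L - i - \<sigma> - (a - b) - 2 * w)
        * gb (w + \<sigma> + b) (\<sigma> + b) * gb (w + (a - b) + \<sigma> - b) (\<sigma> - b)))"
  let ?C = "{0..L - i - \<sigma> - (a - b)}"
  let ?B = "{w \<in> ?C. ?g w \<noteq> 0}"
  have fg: "?f w = ?g (w + b - \<sigma>)" for w
  proof -
    have "gb \<sigma> (i - (L-a-b-2*w)) = gb \<sigma> (\<sigma> - (i - (L-a-b-2*w)))"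
      using assms by (simp add: gb_sym)
    then have 1: "gb \<sigma> (i - (L-a-b-2*w)) = gb \<sigma> (L - i - \<sigma> - (a - b) - 2 * (w + b - \<sigma>))"
      by (simp add: algebra_simps)
    have "s powi (b\<^sup>2 + (L-a-b-2*w)\<^sup>2 + 2 * (\<sigma>\<^sup>2 - b\<^sup>2) + 2 * ((i-\<sigma>)*(i-(L-a-b-2*w))))
       = s powi ((i\<^sup>2 - b\<^sup>2) + (\<sigma>\<^sup>2 + (L - i - \<sigma> - (a - b) - 2 * (w + b - \<sigma>))\<^sup>2))"
      by (rule arg_cong[where f = "\<lambda>k. s powi k"]) (simp add: power2_eq_square algebra_simps)
    then have 2: "s powi (b\<^sup>2 + (L-a-b-2*w)\<^sup>2 + 2 * (\<sigma>\<^sup>2 - b\<^sup>2) + 2 * ((i-\<sigma>)*(i-(L-a-b-2*w))))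
       = s powi (i\<^sup>2 - b\<^sup>2) * (s powi \<sigma>\<^sup>2 * s powi (L - i - \<sigma> - (a - b) - 2 * (w + b - \<sigma>))\<^sup>2)"
      using s_nz by (simp add: power_int_add)
    have 3: "w + b - \<sigma> + \<sigma> + b = w + 2 * b" "w + b - \<sigma> + (a - b) + \<sigma> - b = w + a - b" by simp_all
    show ?thesis unfolding 1 2 3 by (simp only: mult_ac)
  qed
  \<comment> \<open>The shift does not map one range of w onto the other, so it is applied to the
    nonzero terms only.\<close>
  have "sum ?f {0..L-a-b} = sum ?f ?A"
    by (rule sum.mono_neutral_right) auto
  also have "\<dots> = sum ?g ?B"
  proof (rule sum.reindex_bij_witness[of _ "\<lambda>w. w + \<sigma> - b" "\<lambda>w. w + b - \<sigma>"])
    fix w assume w: "w \<in> ?A"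
    then have nz: "?f w \<noteq> 0" by blast
    have "w \<ge> \<sigma> - b"
    proof (rule ccontr)
      assume "\<not> \<sigma> - b \<le> w"
      \<comment> \<open>b \<ge> 0 makes the top entry nonnegative; a negative one would not force
        the value 0.\<close>
      then have "gb (w + 2 * b) (\<sigma> + b) = 0" using w assms by (intro gb_eq_0) auto
      with nz show False by simp
    qed
    moreover have "L - i - \<sigma> - (a - b) - 2 * (w + b - \<sigma>) \<ge> 0"
    proof (rule ccontr)
      assume "\<not> ?thesis"
      then have "gb \<sigma> (L - i - \<sigma> - (a - b) - 2 * (w + b - \<sigma>)) = 0" by (intro gb_neg) linarith
      then have "?g (w + b - \<sigma>) = 0" by (simp only: mult_zero_left mult_zero_right)
      with nz show False by (simp only: fg)
    qed
    ultimately have "w + b - \<sigma> \<in> ?C" by simp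
    moreover have "?g (w + b - \<sigma>) \<noteq> 0" using nz by (subst fg[symmetric])
    ultimately show "w + b - \<sigma> \<in> ?B" by blast
  next
    fix w assume w: "w \<in> ?B"
    then have nz: "?g w \<noteq> 0" by blast
    have "L - i - \<sigma> - (a - b) - 2 * w \<ge> 0"
    proof (rule ccontr)
      assume "\<not> ?thesis"
      then have "gb \<sigma> (L - i - \<sigma> - (a - b) - 2 * w) = 0" by (intro gb_neg) linarith
      then have "?g w = 0" by (simp only: mult_zero_left mult_zero_right)
      with nz show False by blast
    qed
    then have "w + \<sigma> - b \<in> {0..L-a-b}" using w sb assms by simp
    moreover have "?f (w + \<sigma> - b) \<noteq> 0"
    proof -
      have "w + \<sigma> - b + b - \<sigma> = w" by simp
      then show ?thesis using nz unfolding fg[of "w + \<sigma> - b"] by (simp only: not_False_eq_True)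
    qed
    ultimately show "w + \<sigma> - b \<in> ?A" by blast
  next
    fix w show "?g (w + b - \<sigma>) = ?f w" by (rule fg[symmetric])
  qed auto
  also have "\<dots> = sum ?g ?C"
    by (rule sum.mono_neutral_left) auto
  also have "\<dots> = s powi (i\<^sup>2 - b\<^sup>2) * (s powi \<sigma>\<^sup>2 * RT (L - i - \<sigma>) \<sigma> (a - b) b)"
    unfolding rtrinom_def by (simp only: sum_distrib_left)
  finally show ?thesis .
qed

text \<open>Saalschuetz read from right to left, twice: the last two factors produce the sum over
  \<sigma>, and \<open>gb M n\<close> with the M-dependent factor of that sum produces the sum over
  i. Afterwards M enters the summand only through \<open>gb (L + M - i) (M - i)\<close>, the weight
  of a Burge step.\<close>

lemma gb_triple_product:
  assumes "b \<ge> 0" "M \<ge> b" "w \<ge> 0" and L: "L = n + 2 * w + a + b"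
  shows "gb M n * gb (w + M + b) (M + b) * gb (w + a + M) (M - b)
    = (\<Sum>i\<in>{0..M}. \<Sum>\<sigma>\<in>{0..i}. s powi (2 * (\<sigma>\<^sup>2 - b\<^sup>2) + 2 * ((i - \<sigma>) * (i - n)))
        * gb (L + M - i) (M - i) * gb (L - \<sigma>) (i - \<sigma>) * gb \<sigma> (i - n)
        * gb (w + a - b) (\<sigma> - b) * gb (w + 2 * b) (\<sigma> + b))"
proof -
  let ?I = "{0..M}"
  let ?R = "\<lambda>\<sigma>. gb (w + a - b) (\<sigma> - b) * gb (w + 2 * b) (\<sigma> + b)"
  \<comment> \<open>Saalschuetz requires x \<ge> 0. That role goes to w + 2 b, since w + a - b may
    be negative.\<close>
  have "gb (w + M + b) (M + b) * gb (w + a + M) (M - b)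
      = (\<Sum>k\<in>{0..M+b}. (s\<^sup>2) powi ((M - b - k) * (M + b - k)) * gb ((w + 2 * b) + (w + a - b) + k) k
           * gb (w + a - b) (M - b - k) * gb (w + 2 * b) (M + b - k))"
    using gb_saalschutz[of "w + 2 * b" "M - b" "M + b" "w + a - b"] assms
    by (simp add: algebra_simps)
  also have "\<dots> = (\<Sum>\<sigma>\<in>{-b..M}. s powi (2 * (\<sigma>\<^sup>2 - b\<^sup>2)) * gb (L - n + M - \<sigma>) (M - \<sigma>) * ?R \<sigma>)"
  proof (rule sum.reindex_bij_witness[of _ "\<lambda>k. M - k" "\<lambda>k. M - k"])
    fix k
    have "(s\<^sup>2) powi ((M - b - k) * (M + b - k)) = s powi (2 * ((M - k)\<^sup>2 - b\<^sup>2))"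
      unfolding square_powi by (rule arg_cong[where f = "\<lambda>k. s powi k"]) (simp add: power2_eq_square algebra_simps)
    then show "s powi (2 * ((M - k)\<^sup>2 - b\<^sup>2)) * gb (L - n + M - (M - k)) (M - (M - k)) * ?R (M - k)
        = (s\<^sup>2) powi ((M - b - k) * (M + b - k)) * gb ((w + 2 * b) + (w + a - b) + k) k
           * gb (w + a - b) (M - b - k) * gb (w + 2 * b) (M + b - k)"
      by (simp add: L algebra_simps)
  qed auto
  also have "\<dots> = (\<Sum>\<sigma>\<in>?I. s powi (2 * (\<sigma>\<^sup>2 - b\<^sup>2)) * gb (L - n + M - \<sigma>) (M - \<sigma>) * ?R \<sigma>)"
    using assms by (intro sum.mono_neutral_right) auto
  finally have 1: "gb (w + M + b) (M + b) * gb (w + a + M) (M - b) = \<dots>" .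
  have 2: "gb M n * gb (L - n + M - \<sigma>) (M - \<sigma>) = (\<Sum>i\<in>?I. s powi (2 * ((i - \<sigma>) * (i - n)))
        * gb (L + M - i) (M - i) * gb (L - \<sigma>) (i - \<sigma>) * gb \<sigma> (i - n))" if "\<sigma> \<in> ?I" for \<sigma>
  proof -
    \<comment> \<open>After this reflection Saalschuetz applies with x = \<sigma>, y = L - \<sigma>,
      \<alpha> = M - \<sigma> and \<beta> = M - n.\<close>
    have "gb M n = gb M (M - n)" using assms by (simp add: gb_sym)
    then have "gb M n * gb (L - n + M - \<sigma>) (M - \<sigma>)
      = (\<Sum>k\<in>{0..M-n}. (s\<^sup>2) powi ((M - \<sigma> - k) * (M - n - k)) * gb (L + k) k
           * gb (L - \<sigma>) (M - \<sigma> - k) * gb \<sigma> (M - n - k))"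
      using gb_saalschutz[of \<sigma> "M - \<sigma>" "M - n" "L - \<sigma>"] that
      by (simp add: algebra_simps)
    also have "\<dots> = (\<Sum>i\<in>{n..M}. s powi (2 * ((i - \<sigma>) * (i - n)))
        * gb (L + M - i) (M - i) * gb (L - \<sigma>) (i - \<sigma>) * gb \<sigma> (i - n))"
      by (rule sum.reindex_bij_witness[of _ "\<lambda>k. M - k" "\<lambda>k. M - k"])
        (auto simp: square_powi algebra_simps)
    also have "\<dots> = (\<Sum>i\<in>{n..M} \<inter> ?I. s powi (2 * ((i - \<sigma>) * (i - n)))
        * gb (L + M - i) (M - i) * gb (L - \<sigma>) (i - \<sigma>) * gb \<sigma> (i - n))"
      using that by (intro sum.mono_neutral_right) auto
    also have "\<dots> = (\<Sum>i\<in>?I. s powi (2 * ((i - \<sigma>) * (i - n)))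
        * gb (L + M - i) (M - i) * gb (L - \<sigma>) (i - \<sigma>) * gb \<sigma> (i - n))"
      using that by (intro sum.mono_neutral_left) auto
    finally show ?thesis .
  qed
  let ?F = "\<lambda>i \<sigma>. s powi (2 * (\<sigma>\<^sup>2 - b\<^sup>2) + 2 * ((i - \<sigma>) * (i - n)))
        * gb (L + M - i) (M - i) * gb (L - \<sigma>) (i - \<sigma>) * gb \<sigma> (i - n)
        * gb (w + a - b) (\<sigma> - b) * gb (w + 2 * b) (\<sigma> + b)"
  have "gb M n * gb (w + M + b) (M + b) * gb (w + a + M) (M - b) =
     (\<Sum>\<sigma>\<in>?I. s powi (2 * (\<sigma>\<^sup>2 - b\<^sup>2)) * ?R \<sigma> * (gb M n * gb (L - n + M - \<sigma>) (M - \<sigma>)))"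
    unfolding mult.assoc[of "gb M n"] 1 by (simp add: sum_distrib_left mult_ac)
  also have "\<dots> = (\<Sum>\<sigma>\<in>?I. \<Sum>i\<in>?I. ?F i \<sigma>)"
  proof (rule sum.cong)
    fix \<sigma> assume \<sigma>: "\<sigma> \<in> ?I"
    have p: "s powi (2 * (\<sigma>\<^sup>2 - b\<^sup>2) + 2 * ((i - \<sigma>) * (i - n))) =
      s powi (2 * (\<sigma>\<^sup>2 - b\<^sup>2)) * s powi (2 * ((i - \<sigma>) * (i - n)))" for i
      using s_nz by (simp add: power_int_add)
    show "s powi (2 * (\<sigma>\<^sup>2 - b\<^sup>2)) * ?R \<sigma> * (gb M n * gb (L - n + M - \<sigma>) (M - \<sigma>)) = (\<Sum>i\<in>?I. ?F i \<sigma>)"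
      unfolding 2[OF \<sigma>] p sum_distrib_left by (simp only: mult_ac)
  qed simp
  also have "\<dots> = (\<Sum>i\<in>?I. \<Sum>\<sigma>\<in>?I. ?F i \<sigma>)" by (rule sum.swap)
  also have "\<dots> = (\<Sum>i\<in>?I. \<Sum>\<sigma>\<in>{0..i}. ?F i \<sigma>)"
    by (intro sum.cong refl sum.mono_neutral_right) auto
  finally show ?thesis .
qed

text \<open>Expanding the right-hand side by \<open>gb_triple_product\<close> turns the coefficient of
  \<open>gb (L + M - i) (M - i)\<close> into the left-hand side at \<open>(L - i, i, a - b)\<close>. So the identity follows from
  its instances with \<open>L - a\<close> replaced by \<open>L - a - (i - b)\<close>, where \<open>i > b\<close>; the cases \<open>i < b\<close> and
  \<open>i = b\<close> are trivial. Since \<open>a\<close> decreases without bound, negative \<open>a\<close> cannot be avoided.\<close>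

theorem RT_burge:
  assumes "b \<ge> 0"
  shows "(\<Sum>i\<in>{0..M}. s powi i\<^sup>2 * gb (L + M - i) (M - i) * RT (L - i) i a b)
       = s powi b\<^sup>2 * RT L M (a + b) b"
proof (induction "nat (L - a + 1)" arbitrary: L M a rule: less_induct)
  case less
  let ?S = "\<lambda>L M a. \<Sum>i\<in>{0..M}. s powi i\<^sup>2 * gb (L + M - i) (M - i) * RT (L - i) i a b"
  consider "M < b" | "M = b" | "M > b" "L - a < b" | "M > b" "L - a \<ge> b" by linarith
  then show ?case
  proof cases
    case 1
    then show ?thesis by (simp add: RT_eq_0)
  next
    case 2
    have "?S L M a = (\<Sum>i\<in>{b}. s powi i\<^sup>2 * gb (L + M - i) (M - i) * RT (L - i) i a b)"
      using 2 assms by (intro sum.mono_neutral_right) (auto simp: RT_eq_0)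
    \<comment> \<open>For M = b the last factor of \<open>rtrinom\<close> has lower entry 0, so it
      is 1 whatever its top entry, and \<open>RT (L - b) b a b\<close> agrees with
      \<open>RT L b (a + b) b\<close> term by term.\<close>
    also have "\<dots> = s powi b\<^sup>2 * RT L b (a + b) b"
      unfolding \<open>M = b\<close> by (simp add: rtrinom_def diff_diff_eq add.commute[of b a])
    finally show ?thesis using 2 by simp
  next
    case 3
    have "?S L M a = 0"
    proof (intro sum.neutral ballI)
      fix i
      show "s powi i\<^sup>2 * gb (L + M - i) (M - i) * RT (L - i) i a b = 0"
        using 3 by (cases "i < b") (auto simp: RT_eq_0 RT_eq_0')
    qed
    then show ?thesis using 3 by (simp add: RT_eq_0')
  next
    case 4
    have IH: "?S (L - i) i (a - b) = s powi b\<^sup>2 * RT (L - i) i a b" for i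
    proof -
      consider "i < b" | "i = b" | "i > b" by linarith
      then show ?thesis
      proof cases
        case 1
        then show ?thesis by (simp add: RT_eq_0)
      next
        case i: 2
        have "?S (L - i) i (a - b) = (\<Sum>j\<in>{b}. s powi j\<^sup>2 * gb (L - i + i - j) (i - j) * RT (L - i - j) j (a - b) b)"
          using i assms by (intro sum.mono_neutral_right) (auto simp: RT_eq_0)
        also have "\<dots> = s powi b\<^sup>2 * RT (L - i) b a b"
          using i by (simp add: rtrinom_def diff_diff_eq add.commute[of b a])
        finally show ?thesis using i by simp
      next
        case 3
        \<comment> \<open>The drop is i - b > 0, and L - a \<ge> b \<ge> 0 ensures that
          \<open>nat\<close> does not hide it by truncation.\<close>
        have "nat (L - i - (a - b) + 1) < nat (L - a + 1)" using 3 4 assms by linarith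
        from less[OF this, of i] show ?thesis by simp
      qed
    qed
    let ?e = "\<lambda>i \<sigma> w. s powi (b\<^sup>2 + (L-a-b-2*w)\<^sup>2 + 2 * (\<sigma>\<^sup>2 - b\<^sup>2) + 2 * ((i-\<sigma>)*(i-(L-a-b-2*w))))
            * gb \<sigma> (i - (L-a-b-2*w)) * gb (w + a - b) (\<sigma> - b) * gb (w + 2 * b) (\<sigma> + b)"
    have "s powi b\<^sup>2 * RT L M (a + b) b = (\<Sum>w\<in>{0..L-a-b}. s powi b\<^sup>2 * s powi (L-a-b-2*w)\<^sup>2 *
        (gb M (L-a-b-2*w) * gb (w + M + b) (M + b) * gb (w + a + M) (M - b)))"
      by (simp add: rtrinom_def sum_distrib_left diff_diff_eq mult_ac add_ac)
    also have "\<dots> = (\<Sum>w\<in>{0..L-a-b}. \<Sum>i\<in>{0..M}. \<Sum>\<sigma>\<in>{0..i}.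
        gb (L + M - i) (M - i) * gb (L - \<sigma>) (i - \<sigma>) * ?e i \<sigma> w)"
    proof (rule sum.cong)
      fix w assume "w \<in> {0..L-a-b}"
      then have w: "w \<ge> 0" by simp
      have p: "s powi (b\<^sup>2 + (L-a-b-2*w)\<^sup>2 + 2 * (\<sigma>\<^sup>2 - b\<^sup>2) + 2 * ((i-\<sigma>)*(i-(L-a-b-2*w))))
        = s powi b\<^sup>2 * s powi (L-a-b-2*w)\<^sup>2 * s powi (2 * (\<sigma>\<^sup>2 - b\<^sup>2) + 2 * ((i - \<sigma>) * (i - (L-a-b-2*w))))" for i \<sigma>
        unfolding power_int_add[OF disjI1[OF s_nz], symmetric] by (simp only: add.assoc)
      show "s powi b\<^sup>2 * s powi (L-a-b-2*w)\<^sup>2 *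
          (gb M (L-a-b-2*w) * gb (w + M + b) (M + b) * gb (w + a + M) (M - b))
        = (\<Sum>i\<in>{0..M}. \<Sum>\<sigma>\<in>{0..i}. gb (L + M - i) (M - i) * gb (L - \<sigma>) (i - \<sigma>) * ?e i \<sigma> w)"
      proof -
        have "b \<le> M" "L = (L-a-b-2*w) + 2 * w + a + b" using 4 by simp_all
        from gb_triple_product[OF assms this(1) w this(2)]
        have T: "gb M (L-a-b-2*w) * gb (w + M + b) (M + b) * gb (w + a + M) (M - b) =
           (\<Sum>i\<in>{0..M}. \<Sum>\<sigma>\<in>{0..i}. s powi (2 * (\<sigma>\<^sup>2 - b\<^sup>2) + 2 * ((i - \<sigma>) * (i - (L-a-b-2*w))))
            * gb (L + M - i) (M - i) * gb (L - \<sigma>) (i - \<sigma>) * gb \<sigma> (i - (L-a-b-2*w))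
            * gb (w + a - b) (\<sigma> - b) * gb (w + 2 * b) (\<sigma> + b))" .
        show ?thesis unfolding p T sum_distrib_left by (simp only: mult_ac)
      qed
    qed simp
    also have "\<dots> = (\<Sum>i\<in>{0..M}. \<Sum>\<sigma>\<in>{0..i}. \<Sum>w\<in>{0..L-a-b}.
        gb (L + M - i) (M - i) * gb (L - \<sigma>) (i - \<sigma>) * ?e i \<sigma> w)"
      by (subst sum.swap) (intro sum.cong refl sum.swap)
    also have "\<dots> = (\<Sum>i\<in>{0..M}. \<Sum>\<sigma>\<in>{0..i}. gb (L + M - i) (M - i) * gb (L - \<sigma>) (i - \<sigma>) *
        (s powi (i\<^sup>2 - b\<^sup>2) * (s powi \<sigma>\<^sup>2 * RT (L - i - \<sigma>) \<sigma> (a - b) b)))"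
      by (intro sum.cong refl) (subst RT_inner[symmetric, OF assms], auto simp: sum_distrib_left)
    also have "\<dots> = (\<Sum>i\<in>{0..M}. gb (L + M - i) (M - i) * s powi (i\<^sup>2 - b\<^sup>2) * ?S (L - i) i (a - b))"
      by (intro sum.cong refl) (simp add: sum_distrib_left mult_ac)
    also have "\<dots> = ?S L M a"
      unfolding IH
    proof (intro sum.cong refl)
      fix i
      have "s powi (i\<^sup>2 - b\<^sup>2) * s powi b\<^sup>2 = s powi i\<^sup>2"
        using s_nz by (simp flip: power_int_add)
      from this[symmetric] show "gb (L + M - i) (M - i) * s powi (i\<^sup>2 - b\<^sup>2) * (s powi b\<^sup>2 * RT (L - i) i a b) =
         s powi i\<^sup>2 * gb (L + M - i) (M - i) * RT (L - i) i a b"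
        by (simp only: mult_ac)
    qed
    finally show ?thesis by simp
  qed
qed

end

subsection \<open>The limit to \<open>T\<^sub>0\<close>\<close>

text \<open>For a \<ge> 0, replacing n by n + a in the sum for - a turns n (n - a) into (n + a) n
  and exchanges two denominators. The skipped terms n < a contain \<open>inv_qpoch\<close> at a
  negative index.\<close>

lemma T0_uminus: "T0 L (- a) s = T0 L a s"
proof -
  have *: "qtrinom L a a q = qtrinom L (- a) (- a) q" if nn: "a \<ge> 0" for a q
  proof -
    obtain c where a: "a = int c" using nn nonneg_int_cases by blast
    let ?f = "\<lambda>n::nat. q powi (int n * (int n + - a)) * (qpoch q q L * inv_qpoch q (int n) * inv_qpoch q (int n + - a)
          * inv_qpoch q (int L - 2 * int n - - a))"
    have "qtrinom L (- a) (- a) q = infsum ?f (range (\<lambda>n. n + c))"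
      unfolding qtrinom_def
    proof (rule infsum_cong_neutral)
      fix n assume "n \<in> UNIV - range (\<lambda>n. n + c)"
      then have "n < c" by (metis DiffD2 le_add_diff_inverse2 not_le rangeI)
      then show "?f n = 0" by (simp add: inv_qpoch_def a)
    qed auto
    also have "\<dots> = infsum (?f \<circ> (\<lambda>n. n + c)) UNIV"
      by (rule infsum_reindex) auto
    also have "?f \<circ> (\<lambda>n. n + c) = (\<lambda>n. q powi (int n * (int n + a)) * (qpoch q q L * inv_qpoch q (int n) * inv_qpoch q (int n + a)
          * inv_qpoch q (int L - 2 * int n - a)))"
      by (rule ext) (simp add: a algebra_simps)
    finally show ?thesis by (simp add: qtrinom_def)
  qed
  have "qtrinom L (- a) (- a) q = qtrinom L a a q" for q
    using *[of a q] *[of "- a" q] by (cases "a \<ge> 0") simp_all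
  then show ?thesis by (simp add: T0_def)
qed

lemma T0_abs: "T0 L \<bar>a\<bar> s = T0 L a s"
  by (cases "a \<ge> 0") (simp_all add: T0_uminus)

section \<open>Inversion of the base\<close>

context sqrt_base
begin

lemma qpoch_inverse:
  "qpoch (inverse (s\<^sup>2)) (inverse (s\<^sup>2)) n = (-1) ^ n * s powi (- (int n * (int n + 1))) * qpoch (s\<^sup>2) (s\<^sup>2) n"
proof (induction n)
  case 0
  then show ?case by (simp add: qpoch_def)
next
  case (Suc n)
  let ?Q = "s\<^sup>2"
  have nz: "?Q ^ Suc n \<noteq> 0" using s_nz by simp
  have "?Q ^ Suc n = s powi (2 * (int n + 1))"
    using s_nz by (metis of_nat_Suc power_int_of_nat square_powi add.commute)
  then have p: "inverse (?Q ^ Suc n) = s powi (- (2 * (int n + 1)))"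
    by (simp only: power_int_minus)
  have "qpoch (inverse ?Q) (inverse ?Q) (Suc n) = qpoch (inverse ?Q) (inverse ?Q) n * (1 - inverse (?Q ^ Suc n))"
    by (simp add: qpoch_def power_inverse)
  also have "1 - inverse (?Q ^ Suc n) = - 1 * inverse (?Q ^ Suc n) * (1 - ?Q ^ Suc n)"
    using nz by (simp add: field_simps)
  also have "qpoch (inverse ?Q) (inverse ?Q) n * \<dots> =
      (-1) ^ Suc n * (s powi (- (int n * (int n + 1))) * s powi (- (2 * (int n + 1)))) * (qpoch ?Q ?Q n * (1 - ?Q ^ Suc n))"
    unfolding Suc p by (simp add: mult_ac)
  also have "s powi (- (int n * (int n + 1))) * s powi (- (2 * (int n + 1))) = s powi (- (int (Suc n) * (int (Suc n) + 1)))"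
    using s_nz by (simp flip: power_int_add add: algebra_simps)
  also have "qpoch ?Q ?Q n * (1 - ?Q ^ Suc n) = qpoch ?Q ?Q (Suc n)"
    by (simp add: qpoch_def)
  finally show ?case .
qed

lemma inv_qpoch_inverse:
  "inv_qpoch (inverse (s\<^sup>2)) k = (-1) powi k * s powi (k * (k + 1)) * inv_qpoch (s\<^sup>2) k"
proof (cases "k < 0")
  case False
  then obtain n where k: "k = int n" by (metis not_less nonneg_int_cases)
  have "(-1 :: complex) ^ n \<noteq> 0" by simp
  moreover have "(-1 :: complex) ^ n * (-1) ^ n = 1"
    by (simp flip: power_mult_distrib)
  ultimately show ?thesis
    using s_nz qpoch_nz[of n]
    unfolding inv_qpoch_def k qpoch_inverse power_int_minus nat_int by (simp add: divide_simps)
qed (simp add: inv_qpoch_def)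

text \<open>Inverting the base contributes a sign and a power of s for every q-factorial. The
  indices w, w + a and L - a - 2 w add up to L, so the signs and the linear parts of the exponents
  cancel; the quadratic parts leave a single square.\<close>

lemma T0_eq:
  assumes "a \<ge> 0"
  shows "T0 L a s = qpoch (s\<^sup>2) (s\<^sup>2) L * (\<Sum>w\<in>{0..int L - a}. s powi (int L - a - 2 * w)\<^sup>2 *
     inv_qpoch (s\<^sup>2) (int L - a - 2 * w) * inv_qpoch (s\<^sup>2) w * inv_qpoch (s\<^sup>2) (w + a))"
proof -
  let ?Q = "s\<^sup>2" and ?R = "inverse (s\<^sup>2)"
  define f where "f = (\<lambda>w::int. ?R powi (w * (w + a)) *
        (qpoch ?R ?R L * inv_qpoch ?R w * inv_qpoch ?R (w + a) * inv_qpoch ?R (int L - 2 * w - a)))"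
  have "qtrinom L a a ?R = infsum (\<lambda>n. f (int n)) UNIV"
    by (simp add: qtrinom_def f_def)
  also have "\<dots> = infsum (\<lambda>n. f (int n)) {..nat (int L - a)}"
    by (rule infsum_cong_neutral) (auto simp: f_def inv_qpoch_def)
  also have "\<dots> = (\<Sum>n\<le>nat (int L - a). f (int n))"
    by simp
  also have "\<dots> = (\<Sum>w\<in>int ` {..nat (int L - a)}. f w)"
    by (simp add: sum.reindex)
  also have "\<dots> = (\<Sum>w\<in>{0..int L - a}. f w)"
  proof (rule sum.mono_neutral_right)
    show "{0..int L - a} \<subseteq> int ` {..nat (int L - a)}"
    proof
      fix w assume "w \<in> {0..int L - a}"
      then have "w = int (nat w)" "nat w \<le> nat (int L - a)" by auto
      then show "w \<in> int ` {..nat (int L - a)}" by blast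
    qed
  qed (auto simp: f_def inv_qpoch_def)
  finally have T: "T0 L a s = (\<Sum>w\<in>{0..int L - a}. s powi ((int L)\<^sup>2 - a\<^sup>2) * f w)"
    by (simp add: T0_def sum_distrib_left)
  have "s powi ((int L)\<^sup>2 - a\<^sup>2) * f w = qpoch ?Q ?Q L * (s powi (int L - a - 2 * w)\<^sup>2 *
     inv_qpoch ?Q (int L - a - 2 * w) * inv_qpoch ?Q w * inv_qpoch ?Q (w + a))" for w
  proof -
    let ?n = "int L - a - 2 * w"
    have n: "int L - 2 * w - a = ?n" by simp
    have "(-1 :: complex) ^ L * ((-1) powi w * (-1) powi (w + a) * (-1) powi ?n) = (-1) powi (2 * int L)"
      by (simp flip: power_int_add power_int_of_nat)
    then have sign: "(-1 :: complex) ^ L * (-1) powi w * (-1) powi (w + a) * (-1) powi ?n = 1"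
      by (simp add: power_int_mult mult.assoc)
    have R: "?R powi (w * (w + a)) = s powi (- 2 * (w * (w + a)))"
      by (simp add: power_int_inverse square_powi power_int_minus)
    have "s powi ((int L)\<^sup>2 - a\<^sup>2) * (s powi (- 2 * (w * (w + a))) * (s powi (- (int L * (int L + 1))) *
        s powi (w * (w + 1)) * s powi ((w + a) * (w + a + 1)) * s powi (?n * (?n + 1))))
      = s powi ((int L)\<^sup>2 - a\<^sup>2 + (- 2 * (w * (w + a)) + (- (int L * (int L + 1)) +
        w * (w + 1) + (w + a) * (w + a + 1) + ?n * (?n + 1))))"
      unfolding power_int_add[OF disjI1[OF s_nz]] by (rule refl)
    also have "\<dots> = s powi ?n\<^sup>2"
      by (rule arg_cong[where f = "\<lambda>k. s powi k"]) (simp add: power2_eq_square algebra_simps)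
    finally have e: "s powi ((int L)\<^sup>2 - a\<^sup>2) * (s powi (- 2 * (w * (w + a))) * (s powi (- (int L * (int L + 1))) *
        s powi (w * (w + 1)) * s powi ((w + a) * (w + a + 1)) * s powi (?n * (?n + 1)))) = s powi ?n\<^sup>2" .
    have "s powi ((int L)\<^sup>2 - a\<^sup>2) * f w =
      ((-1) ^ L * (-1) powi w * (-1) powi (w + a) * (-1) powi ?n) *
      (s powi ((int L)\<^sup>2 - a\<^sup>2) * (s powi (- 2 * (w * (w + a))) * (s powi (- (int L * (int L + 1))) *
        s powi (w * (w + 1)) * s powi ((w + a) * (w + a + 1)) * s powi (?n * (?n + 1))))) *
      (qpoch ?Q ?Q L * inv_qpoch ?Q w * inv_qpoch ?Q (w + a) * inv_qpoch ?Q ?n)"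
      unfolding f_def n qpoch_inverse inv_qpoch_inverse R by (simp only: mult_ac)
    then show ?thesis unfolding sign e by (simp only: mult_ac mult_1_left)
  qed
  then show ?thesis unfolding T by (simp only: sum_distrib_left)
qed

section \<open>Limits as M tends to infinity\<close>

lemma gb_limit: "(\<lambda>m. gb (int m + c) t) \<longlonglongrightarrow> inv_qpoch (s\<^sup>2) t"
proof (cases "t < 0")
  case False
  let ?Q = "s\<^sup>2"
  have Qn: "norm ?Q < 1"
    using norm_s power_less_one_iff[of "norm s" 2] by (simp add: norm_power)
  have "(\<lambda>m. (\<Prod>r<nat t. 1 - ?Q powi (int m + c - int r)) / (\<Prod>r<nat t. 1 - ?Q ^ Suc r))
      \<longlonglongrightarrow> (\<Prod>r<nat t. 1 - 0 * ?Q powi (c - int r)) / (\<Prod>r<nat t. 1 - ?Q ^ Suc r)"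
  proof (intro tendsto_divide tendsto_prod tendsto_diff tendsto_const)
    fix r
    have "?Q powi (int m + c - int r) = ?Q ^ m * ?Q powi (c - int r)" for m
      using power_int_add[of ?Q "int m" "c - int r"] s_nz by (simp add: add_diff_eq)
    then show "(\<lambda>m. ?Q powi (int m + c - int r)) \<longlonglongrightarrow> 0 * ?Q powi (c - int r)"
      by (simp only:) (intro tendsto_mult tendsto_const LIMSEQ_power_zero[OF Qn])
  next
    show "(\<Prod>r<nat t. 1 - ?Q ^ Suc r) \<noteq> 0"
      using not_root by simp
  qed
  then show ?thesis using False by (simp add: gqbinom_def inv_qpoch_def qpoch_def)
qed (simp add: inv_qpoch_def)

text \<open>The last two factors have lower entries that grow with m. Once their top entries are
  nonnegative, symmetry replaces these by the fixed entries w and w + a; then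
  \<open>gb_limit\<close> applies, and b disappears.\<close>

lemma RT_limit:
  assumes "a \<ge> 0"
  shows "(\<lambda>m. RT L (int m) a b) \<longlonglongrightarrow> (\<Sum>w\<in>{0..L - a}. s powi (L - a - 2 * w)\<^sup>2 *
     inv_qpoch (s\<^sup>2) (L - a - 2 * w) * inv_qpoch (s\<^sup>2) w * inv_qpoch (s\<^sup>2) (w + a))"
  unfolding rtrinom_def
proof (intro tendsto_sum tendsto_mult tendsto_const)
  fix w assume w: "w \<in> {0..L - a}"
  show "(\<lambda>m. gb (int m) (L - a - 2 * w)) \<longlonglongrightarrow> inv_qpoch (s\<^sup>2) (L - a - 2 * w)"
    using gb_limit[of 0] by simp
  show "(\<lambda>m. gb (w + int m + b) (int m + b)) \<longlonglongrightarrow> inv_qpoch (s\<^sup>2) w"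
  proof (rule Lim_transform_eventually[OF gb_limit[of "w + b"]])
    show "\<forall>\<^sub>F m in sequentially. gb (int m + (w + b)) w = gb (w + int m + b) (int m + b)"
    proof (rule eventually_sequentiallyI)
      fix m assume "nat \<bar>w + b\<bar> \<le> m"
      then have "int m + (w + b) \<ge> 0" by linarith
      from gb_sym[OF this, of w] show "gb (int m + (w + b)) w = gb (w + int m + b) (int m + b)"
        by (simp add: algebra_simps)
    qed
  qed
  show "(\<lambda>m. gb (w + a + int m - b) (int m - b)) \<longlonglongrightarrow> inv_qpoch (s\<^sup>2) (w + a)"
  proof (rule Lim_transform_eventually[OF gb_limit[of "w + a - b"]])
    show "\<forall>\<^sub>F m in sequentially. gb (int m + (w + a - b)) (w + a) = gb (w + a + int m - b) (int m - b)"
    proof (rule eventually_sequentiallyI)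
      fix m assume "nat \<bar>w + a - b\<bar> \<le> m"
      then have "int m + (w + a - b) \<ge> 0" by linarith
      from gb_sym[OF this, of "w + a"] show "gb (int m + (w + a - b)) (w + a) = gb (w + a + int m - b) (int m - b)"
        by (simp add: algebra_simps)
    qed
  qed
qed

text \<open>Reflected to lower entry L, the weight \<open>gb (L + M - i) (M - i)\<close> of a Burge
  step has a limit that does not depend on i and cancels against the factor (s^2; s^2)_L of
  \<open>T0_eq\<close>.\<close>

theorem RT_burge_limit:
  assumes "a \<ge> 0" "b \<ge> 0"
  shows "(\<Sum>i\<in>{0..int L}. s powi i\<^sup>2 * RT (int L - i) i a b) = s powi b\<^sup>2 * T0 L (a + b) s"
proof -
  let ?P = "qpoch (s\<^sup>2) (s\<^sup>2) L"
  let ?S = "\<Sum>i\<in>{0..int L}. s powi i\<^sup>2 * RT (int L - i) i a b"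
  have inv: "inv_qpoch (s\<^sup>2) (int L) = 1 / ?P" by (simp add: inv_qpoch_def)
  have "(\<lambda>m. \<Sum>i\<in>{0..int L}. s powi i\<^sup>2 * gb (int m + (int L - i)) (int L) * RT (int L - i) i a b)
     \<longlonglongrightarrow> (\<Sum>i\<in>{0..int L}. s powi i\<^sup>2 * inv_qpoch (s\<^sup>2) (int L) * RT (int L - i) i a b)"
    by (intro tendsto_sum tendsto_mult tendsto_const gb_limit)
  moreover have "(\<lambda>m. \<Sum>i\<in>{0..int L}. s powi i\<^sup>2 * gb (int m + (int L - i)) (int L) * RT (int L - i) i a b)
     \<longlonglongrightarrow> s powi b\<^sup>2 * (T0 L (a + b) s / ?P)"
  proof (rule Lim_transform_eventually)
    show "(\<lambda>m. s powi b\<^sup>2 * RT (int L) (int m) (a + b) b) \<longlonglongrightarrow> s powi b\<^sup>2 * (T0 L (a + b) s / ?P)"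
      using RT_limit[of "a + b" "int L" b] assms qpoch_nz[of L]
      by (intro tendsto_mult tendsto_const) (simp add: T0_eq)
    show "\<forall>\<^sub>F m in sequentially. s powi b\<^sup>2 * RT (int L) (int m) (a + b) b =
      (\<Sum>i\<in>{0..int L}. s powi i\<^sup>2 * gb (int m + (int L - i)) (int L) * RT (int L - i) i a b)"
    proof (rule eventually_sequentiallyI)
      fix m assume m: "L \<le> m"
      have "s powi b\<^sup>2 * RT (int L) (int m) (a + b) b =
        (\<Sum>i\<in>{0..int m}. s powi i\<^sup>2 * gb (int L + int m - i) (int m - i) * RT (int L - i) i a b)"
        using RT_burge[OF assms(2)] by simp
      \<comment> \<open>For i > L the factor \<open>RT (int L - i) i a b\<close> vanishes because a
        \<ge> 0. So the number of terms stays fixed and the limit can be taken term by term.\<close>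
      also have "\<dots> = (\<Sum>i\<in>{0..int L}. s powi i\<^sup>2 * gb (int L + int m - i) (int m - i) * RT (int L - i) i a b)"
        using m assms by (intro sum.mono_neutral_right) (auto simp: RT_eq_0')
      also have "\<dots> = (\<Sum>i\<in>{0..int L}. s powi i\<^sup>2 * gb (int m + (int L - i)) (int L) * RT (int L - i) i a b)"
      proof (rule sum.cong)
        fix i assume "i \<in> {0..int L}"
        then have "int m + (int L - i) \<ge> 0" using m by auto
        from gb_sym[OF this, of "int L"]
        show "s powi i\<^sup>2 * gb (int L + int m - i) (int m - i) * RT (int L - i) i a b =
          s powi i\<^sup>2 * gb (int m + (int L - i)) (int L) * RT (int L - i) i a b"
          by (simp add: algebra_simps)
      qed simp
      finally show "s powi b\<^sup>2 * RT (int L) (int m) (a + b) b = \<dots>" .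
    qed
  qed
  ultimately have "(\<Sum>i\<in>{0..int L}. s powi i\<^sup>2 * inv_qpoch (s\<^sup>2) (int L) * RT (int L - i) i a b)
    = s powi b\<^sup>2 * (T0 L (a + b) s / ?P)"
    by (rule LIMSEQ_unique)
  moreover have "(\<Sum>i\<in>{0..int L}. s powi i\<^sup>2 * inv_qpoch (s\<^sup>2) (int L) * RT (int L - i) i a b) = ?S / ?P"
    unfolding inv sum_divide_distrib by (rule sum.cong) simp_all
  ultimately show ?thesis using qpoch_nz[of L] by simp
qed

end

subsection \<open>The start of the chain\<close>

lemma sum_shift_support:
  fixes f :: "int \<Rightarrow> 'a::comm_monoid_add"
  assumes "finite A" "finite B" and supp: "\<And>x. f x \<noteq> 0 \<Longrightarrow> x \<in> A \<and> x - c \<in> B"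
  shows "sum f A = (\<Sum>y\<in>B. f (y + c))"
proof -
  have "sum f A = sum f {x \<in> A. f x \<noteq> 0}"
    using assms by (intro sum.mono_neutral_right) auto
  also have "\<dots> = (\<Sum>y\<in>{y \<in> B. f (y + c) \<noteq> 0}. f (y + c))"
  proof (rule sum.reindex_bij_witness[of _ "\<lambda>y. y + c" "\<lambda>x. x - c"])
    fix y assume "y \<in> {y \<in> B. f (y + c) \<noteq> 0}"
    then show "y + c \<in> {x \<in> A. f x \<noteq> 0}" using supp[of "y + c"] by blast
  qed (use supp in auto)
  also have "\<dots> = (\<Sum>y\<in>B. f (y + c))"
    using assms by (intro sum.mono_neutral_left) auto
  finally show ?thesis .
qed

text \<open>The index is an integer so that a convolution index m - i may become negative and values
  can be compared with \<open>gb\<close>.\<close>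

definition icoeff :: "complex poly \<Rightarrow> int \<Rightarrow> complex" where
  "icoeff p k = (if k < 0 then 0 else coeff p (nat k))"

lemma icoeff_mult:
  assumes "m \<le> N"
  shows "icoeff (p * r) m = (\<Sum>i\<in>{0..N}. icoeff p i * icoeff r (m - i))"
proof (cases "m < 0")
  case True
  then show ?thesis by (simp add: icoeff_def)
next
  case False
  then obtain n where m: "m = int n" by (metis not_less nonneg_int_cases)
  have "icoeff (p * r) m = (\<Sum>i\<le>n. coeff p i * coeff r (n - i))"
    by (simp add: icoeff_def m coeff_mult)
  also have "\<dots> = (\<Sum>i\<in>{0..m}. icoeff p i * icoeff r (m - i))"
    by (rule sum.reindex_bij_witness[of _ nat int]) (auto simp: m icoeff_def nat_diff_distrib)
  also have "\<dots> = (\<Sum>i\<in>{0..N}. icoeff p i * icoeff r (m - i))"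
    using assms by (intro sum.mono_neutral_left) (auto simp: icoeff_def)
  finally show ?thesis .
qed

context sqrt_base
begin

text \<open>The finite q-binomial theorem for (-u s z; s^2)_M; multiplication by one more linear
  factor is a Pascal rule.\<close>

lemma icoeff_euler_product:
  assumes "u \<noteq> 0"
  shows "icoeff (\<Prod>i<M. [:1, u * s ^ (2 * i + 1):]) k = u powi k * s powi k\<^sup>2 * gb (int M) k"
proof (induction M arbitrary: k)
  case 0
  show ?case
    by (cases "k = 0") (auto simp: icoeff_def gb_eq_0 coeff_eq_0 split: if_splits)
next
  case (Suc M)
  let ?p = "\<Prod>i<M. [:1, u * s ^ (2 * i + 1):]"
  have rec: "icoeff (p * [:1, c:]) k = icoeff p k + c * icoeff p (k - 1)" for p c
  proof -
    have "p * [:1, c:] = p + pCons 0 (smult c p)" by (simp add: mult.commute)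
    then show ?thesis
      by (cases "k \<le> 0") (auto simp: icoeff_def coeff_pCons nat_diff_distrib split: nat.splits)
  qed
  have e1: "u * u powi (k - 1) = u powi k"
    using power_int_add[of u 1 "k - 1"] assms by simp
  have e2: "s ^ (2 * M + 1) * s powi (k - 1)\<^sup>2 = s powi k\<^sup>2 * (s\<^sup>2) powi (int M + 1 - k)"
  proof -
    have "s ^ (2 * M + 1) = s powi (2 * int M + 1)"
    proof -
      have "2 * int M + 1 = int (2 * M + 1)" by simp
      then show ?thesis by (simp only: power_int_of_nat)
    qed
    then show ?thesis
      unfolding square_powi using s_nz by (simp add: power2_eq_square algebra_simps flip: power_int_add)
  qed
  have "icoeff (?p * [:1, u * s ^ (2 * M + 1):]) k
     = u powi k * s powi k\<^sup>2 * gb (int M) k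
       + (u * u powi (k - 1)) * (s ^ (2 * M + 1) * s powi (k - 1)\<^sup>2) * gb (int M) (k - 1)"
    unfolding rec Suc by (simp only: mult_ac)
  also have "\<dots> = u powi k * s powi k\<^sup>2 * gb (int M + 1) k"
    unfolding e1 e2 pascal1[of "int M" k] by (simp only: distrib_left mult_ac)
  finally show ?case by (simp add: add.commute)
qed

text \<open>With both parameters equal to b \<ge> 0, reflection makes the last two factors a
  Saalschuetz product with x = y = M, \<alpha> = w + b, \<beta> = w; then t = w - k. The three
  coefficients with top entry M are what a product of three q-binomial expansions yields.\<close>

lemma RT_diag:
  assumes "L \<le> N" "M \<ge> 0"
  shows "s powi j\<^sup>2 * RT L M \<bar>j\<bar> \<bar>j\<bar> = (\<Sum>k\<in>{0..N}. \<Sum>t\<in>{0..N}. gb (2 * M + k) k *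
    (s powi ((L - 2 * k - 2 * t - j)\<^sup>2 + (t + j)\<^sup>2 + t\<^sup>2) *
      gb M (L - 2 * k - 2 * t - j) * gb M (t + j) * gb M t))"
proof -
  define E where "E = (\<lambda>j k t. gb (2 * M + k) k * (s powi ((L - 2 * k - 2 * t - j)\<^sup>2 + (t + j)\<^sup>2 + t\<^sup>2) *
      gb M (L - 2 * k - 2 * t - j) * gb M (t + j) * gb M t))"
  have supp: "t \<ge> 0 \<and> L - 2 * k - 2 * t - j \<ge> 0" if "E j k t \<noteq> 0" for j k t
  proof (rule ccontr)
    assume "\<not> ?thesis"
    then have "gb M t = 0 \<or> gb M (L - 2 * k - 2 * t - j) = 0"
      by (metis gb_neg not_less)
    with that show False unfolding E_def by auto
  qed
  have pos: "s powi b\<^sup>2 * RT L M b b = (\<Sum>k\<in>{0..N}. \<Sum>t\<in>{0..N}. E b k t)" if b: "b \<ge> 0" for b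
  proof -
    have 1: "s powi b\<^sup>2 * (s powi (L - b - 2 * w)\<^sup>2 * gb M (L - b - 2 * w) * gb (w + M + b) (M + b) * gb (w + b + M - b) (M - b))
      = (\<Sum>k\<in>{0..N}. E b k (w - k))" if w: "w \<in> {0..L-b}" for w
    proof -
      have "gb (w + M + b) (M + b) = gb (M + (w + b)) w"
        using gb_sym[of "w + M + b" w] w b assms by (simp add: algebra_simps)
      moreover have "gb (w + b + M - b) (M - b) = gb (M + w) (w + b)"
        using gb_sym[of "w + M" "w + b"] w b assms by (simp add: algebra_simps)
      ultimately have "gb (w + M + b) (M + b) * gb (w + b + M - b) (M - b) =
        (\<Sum>k\<in>{0..w}. (s\<^sup>2) powi ((w + b - k) * (w - k)) * gb (M + M + k) k * gb M (w + b - k) * gb M (w - k))"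
        using gb_saalschutz[of M "w + b" w M] assms by simp
      also have "\<dots> = (\<Sum>k\<in>{0..N}. (s\<^sup>2) powi ((w + b - k) * (w - k)) * gb (M + M + k) k * gb M (w + b - k) * gb M (w - k))"
        using w b assms by (intro sum.mono_neutral_left) auto
      finally have S: "gb (w + M + b) (M + b) * gb (w + b + M - b) (M - b) = \<dots>" .
      have p: "s powi ((L - 2 * k - 2 * (w - k) - b)\<^sup>2 + (w - k + b)\<^sup>2 + (w - k)\<^sup>2)
         = s powi b\<^sup>2 * s powi (L - b - 2 * w)\<^sup>2 * (s\<^sup>2) powi ((w + b - k) * (w - k))" for k
      proof -
        have "(L - 2 * k - 2 * (w - k) - b)\<^sup>2 + (w - k + b)\<^sup>2 + (w - k)\<^sup>2 = b\<^sup>2 + (L - b - 2 * w)\<^sup>2 + 2 * ((w + b - k) * (w - k))"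
          by (simp add: power2_eq_square algebra_simps)
        then show ?thesis
          unfolding square_powi power_int_add[OF disjI1[OF s_nz], symmetric] by (rule arg_cong)
      qed
      have i: "L - 2 * k - 2 * (w - k) - b = L - b - 2 * w" "w - k + b = w + b - k" "2 * M + k = M + M + k" for k
        by simp_all
      have "s powi b\<^sup>2 * (s powi (L - b - 2 * w)\<^sup>2 * gb M (L - b - 2 * w) * gb (w + M + b) (M + b) * gb (w + b + M - b) (M - b))
        = s powi b\<^sup>2 * s powi (L - b - 2 * w)\<^sup>2 * gb M (L - b - 2 * w) * (gb (w + M + b) (M + b) * gb (w + b + M - b) (M - b))"
        by (simp only: mult_ac)
      also have "\<dots> = (\<Sum>k\<in>{0..N}. E b k (w - k))"
        unfolding S E_def p unfolding i sum_distrib_left by (simp only: mult_ac)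
      finally show ?thesis .
    qed
    have "s powi b\<^sup>2 * RT L M b b = (\<Sum>w\<in>{0..L-b}. \<Sum>k\<in>{0..N}. E b k (w - k))"
      unfolding rtrinom_def sum_distrib_left using 1 by (rule sum.cong[OF refl])
    also have "\<dots> = (\<Sum>k\<in>{0..N}. \<Sum>w\<in>{0..L-b}. E b k (w - k))"
      by (rule sum.swap)
    also have "\<dots> = (\<Sum>k\<in>{0..N}. \<Sum>t\<in>{0..N}. E b k t)"
    proof (rule sum.cong[OF refl])
      fix k assume k: "k \<in> {0..N}"
      have "(\<Sum>w\<in>{0..L-b}. E b k (w - k)) = (\<Sum>t\<in>{0..N}. E b k (t + k - k))"
      proof (rule sum_shift_support)
        fix w assume "E b k (w - k) \<noteq> 0"
        from supp[OF this] show "w \<in> {0..L-b} \<and> w - k \<in> {0..N}"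
          using k b assms by auto
      qed auto
      then show "(\<Sum>w\<in>{0..L-b}. E b k (w - k)) = (\<Sum>t\<in>{0..N}. E b k t)" by simp
    qed
    finally show ?thesis .
  qed
  \<comment> \<open>Replacing t by t + j exchanges the last two factors and turns - j into j, so the
    expansion holds with j itself in place of |j|.\<close>
  have "(\<Sum>k\<in>{0..N}. \<Sum>t\<in>{0..N}. E \<bar>j\<bar> k t) = (\<Sum>k\<in>{0..N}. \<Sum>t\<in>{0..N}. E j k t)"
  proof (cases "j \<ge> 0")
    case False
    have "(\<Sum>t\<in>{0..N}. E (- j) k t) = (\<Sum>t\<in>{0..N}. E (- j) k (t + j))" if "k \<in> {0..N}" for k
    proof (rule sum_shift_support)
      fix t assume "E (- j) k t \<noteq> 0"
      from supp[OF this] show "t \<in> {0..N} \<and> t - j \<in> {0..N}"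
        using that False assms by auto
    qed auto
    moreover have "E (- j) k (t + j) = E j k t" for k t
    proof -
      have "L - 2 * k - 2 * (t + j) - - j = L - 2 * k - 2 * t - j" "t + j + - j = t" by simp_all
      then show ?thesis unfolding E_def by (simp only: mult_ac add_ac)
    qed
    ultimately show ?thesis using False by simp
  qed simp
  then show ?thesis using pos[of "\<bar>j\<bar>"] by (simp add: E_def)
qed

end

section \<open>Splitting a product in base q^2 into three in base q^6\<close>

lemma prod_lessThan_triple:
  fixes f :: "nat \<Rightarrow> 'a::comm_monoid_mult"
  shows "(\<Prod>i<3 * M. f i) = (\<Prod>i<M. f (3 * i + 2)) * ((\<Prod>i<M. f (3 * i)) * (\<Prod>i<M. f (3 * i + 1)))"
  by (induction M) (simp_all add: mult_ac numeral_3_eq_3)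

locale capparelli = sqrt_base q for q
begin

sublocale cube: sqrt_base "q ^ 3"
proof
  show "q ^ 3 \<noteq> 0" using s_nz by simp
  show "norm (q ^ 3) < 1" using norm_s power_less_one_iff[of "norm q" 3] by (simp add: norm_power)
qed

text \<open>Both sides are the coefficient of z^m in the product of 1 + z q^(2i+1) over i < 3 M.
  Sorting i by its residue mod 3 gives three products in base q^6 with u = q^2, 1, q^(-2). Their
  degrees are t + j, m - 2 t - j and t, hence the weight q^(2 j).\<close>

lemma triple_product_coeff:
  assumes "m \<le> N" "N \<ge> 0"
  shows "(\<Sum>j\<in>{-N..N}. \<Sum>t\<in>{0..N}. q powi (2 * j) * ((q ^ 3) powi ((m - 2 * t - j)\<^sup>2 + (t + j)\<^sup>2 + t\<^sup>2) *
      cube.gb (int M) (m - 2 * t - j) * cube.gb (int M) (t + j) * cube.gb (int M) t))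
    = q powi m\<^sup>2 * gb (3 * int M) m"
proof -
  let ?s = "q ^ 3"
  define A B C where "A = (\<Prod>i<M. [:1, q ^ 2 * ?s ^ (2 * i + 1):])"
    and "B = (\<Prod>i<M. [:1, 1 * ?s ^ (2 * i + 1):])"
    and "C = (\<Prod>i<M. [:1, inverse (q ^ 2) * ?s ^ (2 * i + 1):])"
  note ABC = A_def B_def C_def
  have P: "(\<Prod>i<3 * M. [:1, 1 * q ^ (2 * i + 1):]) = A * (C * B)"
  proof -
    have "q ^ (2 * (3 * i + 2) + 1) = q ^ 2 * ?s ^ (2 * i + 1)" for i
    proof -
      have "2 * (3 * i + 2) + 1 = 2 + 3 * (2 * i + 1)" by simp
      then show ?thesis by (simp only: power_add[of q 2] power_mult[of q 3])
    qed
    moreover have "q ^ (2 * (3 * i) + 1) = inverse (q ^ 2) * ?s ^ (2 * i + 1)" for i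
    proof -
      have "2 + (2 * (3 * i) + 1) = 3 * (2 * i + 1)" by simp
      then have "q ^ 2 * q ^ (2 * (3 * i) + 1) = ?s ^ (2 * i + 1)"
        by (simp only: power_add[of q 2, symmetric] power_mult[of q 3])
      from this[symmetric] show ?thesis using s_nz by simp
    qed
    moreover have "q ^ (2 * (3 * i + 1) + 1) = ?s ^ (2 * i + 1)" for i
    proof -
      have "2 * (3 * i + 1) + 1 = 3 * (2 * i + 1)" by simp
      then show ?thesis by (simp only: power_mult[of q 3])
    qed
    ultimately show ?thesis unfolding prod_lessThan_triple ABC by (simp only: mult_1_left)
  qed
  have q2: "q ^ 2 \<noteq> 0" "inverse (q ^ 2) \<noteq> 0" using s_nz by simp_all
  have A: "icoeff A r = (q ^ 2) powi r * (?s powi r\<^sup>2 * cube.gb (int M) r)" for r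
    unfolding A_def cube.icoeff_euler_product[OF q2(1)] by (rule mult.assoc)
  have C: "icoeff C r = (q ^ 2) powi (- r) * (?s powi r\<^sup>2 * cube.gb (int M) r)" for r
    unfolding C_def cube.icoeff_euler_product[OF q2(2)] by (simp add: power_int_inverse power_int_minus)
  have B: "icoeff B r = ?s powi r\<^sup>2 * cube.gb (int M) r" for r
    unfolding B_def cube.icoeff_euler_product[OF one_neq_zero] by simp
  have summand: "icoeff A r * (icoeff C t * icoeff B (m - r - t)) =
      q powi (2 * (r - t)) * (?s powi ((m - r - t)\<^sup>2 + r\<^sup>2 + t\<^sup>2) *
      cube.gb (int M) (m - r - t) * cube.gb (int M) r * cube.gb (int M) t)" for r t
  proof -
    have "q powi (2 * (r - t)) = (q ^ 2) powi r * (q ^ 2) powi (- t)"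
      unfolding square_powi power_int_add[OF disjI1[OF s_nz], symmetric] by (simp add: algebra_simps)
    then show ?thesis
      unfolding A B C power_int_add[OF disjI1[OF cube.s_nz]] by (simp only: mult_ac)
  qed
  have "q powi m\<^sup>2 * gb (3 * int M) m = icoeff (A * (C * B)) m"
    using icoeff_euler_product[OF one_neq_zero, of "3 * M" m] unfolding P by simp
  also have "\<dots> = (\<Sum>r\<in>{0..N}. icoeff A r * (\<Sum>t\<in>{0..N}. icoeff C t * icoeff B (m - r - t)))"
    unfolding icoeff_mult[OF assms(1)]
    using assms(1) by (intro sum.cong refl arg_cong2[where f = "(*)"] icoeff_mult) auto
  also have "\<dots> = (\<Sum>t\<in>{0..N}. \<Sum>r\<in>{0..N}. icoeff A r * (icoeff C t * icoeff B (m - r - t)))"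
    unfolding sum_distrib_left by (rule sum.swap)
  also have "\<dots> = (\<Sum>t\<in>{0..N}. \<Sum>j\<in>{-N..N}. icoeff A (j + t) * (icoeff C t * icoeff B (m - (j + t) - t)))"
  proof (rule sum.cong[OF refl], rule sum_shift_support)
    fix t r assume t: "t \<in> {0..N}" and nz: "icoeff A r * (icoeff C t * icoeff B (m - r - t)) \<noteq> 0"
    from nz have "r \<ge> 0" "m - r - t \<ge> 0" by (auto simp: icoeff_def split: if_splits)
    then show "r \<in> {0..N} \<and> r - t \<in> {-N..N}" using t assms by auto
  qed auto
  also have "\<dots> = (\<Sum>j\<in>{-N..N}. \<Sum>t\<in>{0..N}. icoeff A (j + t) * (icoeff C t * icoeff B (m - (j + t) - t)))"
    by (rule sum.swap)
  also have "\<dots> = (\<Sum>j\<in>{-N..N}. \<Sum>t\<in>{0..N}. q powi (2 * j) * ((q ^ 3) powi ((m - 2 * t - j)\<^sup>2 + (t + j)\<^sup>2 + t\<^sup>2) *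
      cube.gb (int M) (m - 2 * t - j) * cube.gb (int M) (t + j) * cube.gb (int M) t))"
  proof (intro sum.cong refl)
    fix j t
    have "m - (j + t) - t = m - 2 * t - j" "j + t - t = j" "j + t = t + j" by simp_all
    then show "icoeff A (j + t) * (icoeff C t * icoeff B (m - (j + t) - t)) =
      q powi (2 * j) * ((q ^ 3) powi ((m - 2 * t - j)\<^sup>2 + (t + j)\<^sup>2 + t\<^sup>2) *
      cube.gb (int M) (m - 2 * t - j) * cube.gb (int M) (t + j) * cube.gb (int M) t)"
      unfolding summand by (simp only:)
  qed
  finally show ?thesis ..
qed

text \<open>The sum over m in the theorem, with n_\<nu> = M and L reduced by N_1 + ... + N_\<nu>.
  The bound N is kept apart from L: it remains fixed along the chain, while the reduced L varies and
  may be negative.\<close>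

definition seed :: "int \<Rightarrow> int \<Rightarrow> nat \<Rightarrow> complex" where
  "seed N L M = (\<Sum>m\<in>{m. int m \<le> N \<and> even (L + int m)}. q ^ m\<^sup>2 * qbinom (q ^ 2) (3 * int M) (int m)
      * qbinom (q ^ 6) (2 * int M + (L - int m) div 2) (2 * int M))"

text \<open>Expand by \<open>RT_diag\<close> and, for fixed k, sum over j and t by
  \<open>triple_product_coeff\<close> at degree m = L - 2 k. This is the origin of the parity
  condition and of the entry (L - m)/2.\<close>

lemma seed_eq_RT:
  assumes "L \<le> N" "N \<ge> 0"
  shows "seed N L M = (\<Sum>j\<in>{-N..N}. q powi (3 * j\<^sup>2 + 2 * j) * rtrinom (q ^ 3) L (int M) \<bar>j\<bar> \<bar>j\<bar>)"
proof -
  have q6: "(q ^ 3)\<^sup>2 = q ^ 6" by (simp flip: power_mult)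
  let ?F = "\<lambda>j k t. (q ^ 3) powi ((L - 2 * k - 2 * t - j)\<^sup>2 + (t + j)\<^sup>2 + t\<^sup>2) *
      cube.gb (int M) (L - 2 * k - 2 * t - j) * cube.gb (int M) (t + j) * cube.gb (int M) t"
  have "(\<Sum>j\<in>{-N..N}. q powi (3 * j\<^sup>2 + 2 * j) * rtrinom (q ^ 3) L (int M) \<bar>j\<bar> \<bar>j\<bar>)
     = (\<Sum>j\<in>{-N..N}. q powi (2 * j) * ((q ^ 3) powi j\<^sup>2 * rtrinom (q ^ 3) L (int M) \<bar>j\<bar> \<bar>j\<bar>))"
  proof (rule sum.cong[OF refl])
    fix j
    have "(q ^ 3) powi j\<^sup>2 = q powi (3 * j\<^sup>2)" by (simp add: power_int_mult)
    then have "q powi (3 * j\<^sup>2 + 2 * j) = q powi (2 * j) * (q ^ 3) powi j\<^sup>2"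
      using s_nz by (simp add: power_int_add)
    then show "q powi (3 * j\<^sup>2 + 2 * j) * rtrinom (q ^ 3) L (int M) \<bar>j\<bar> \<bar>j\<bar>
      = q powi (2 * j) * ((q ^ 3) powi j\<^sup>2 * rtrinom (q ^ 3) L (int M) \<bar>j\<bar> \<bar>j\<bar>)"
      by (simp only: mult.assoc)
  qed
  also have "\<dots> = (\<Sum>j\<in>{-N..N}. \<Sum>k\<in>{0..N}. \<Sum>t\<in>{0..N}. cube.gb (2 * int M + k) k * (q powi (2 * j) * ?F j k t))"
    unfolding cube.RT_diag[OF assms(1) of_nat_0_le_iff] sum_distrib_left by (simp only: mult_ac)
  also have "\<dots> = (\<Sum>k\<in>{0..N}. \<Sum>j\<in>{-N..N}. \<Sum>t\<in>{0..N}. cube.gb (2 * int M + k) k * (q powi (2 * j) * ?F j k t))"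
    by (rule sum.swap)
  also have "\<dots> = (\<Sum>k\<in>{0..N}. cube.gb (2 * int M + k) k * (q powi (L - 2 * k)\<^sup>2 * gb (3 * int M) (L - 2 * k)))"
  proof (rule sum.cong[OF refl])
    fix k assume "k \<in> {0..N}"
    then have k: "L - 2 * k \<le> N" using assms by auto
    show "(\<Sum>j\<in>{-N..N}. \<Sum>t\<in>{0..N}. cube.gb (2 * int M + k) k * (q powi (2 * j) * ?F j k t))
      = cube.gb (2 * int M + k) k * (q powi (L - 2 * k)\<^sup>2 * gb (3 * int M) (L - 2 * k))"
      unfolding triple_product_coeff[OF k assms(2), symmetric] sum_distrib_left by (rule refl)
  qed
  also have "\<dots> = (\<Sum>k\<in>{k \<in> {0..N}. 2 * k \<le> L}. cube.gb (2 * int M + k) k * (q powi (L - 2 * k)\<^sup>2 * gb (3 * int M) (L - 2 * k)))"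
    by (rule sum.mono_neutral_right) (auto simp del: gb_neg intro!: gb_neg)
  also have "\<dots> = (\<Sum>m\<in>{m. int m \<le> N \<and> even (L + int m) \<and> int m \<le> L}. q ^ m\<^sup>2 * qbinom (q ^ 2) (3 * int M) (int m)
      * qbinom (q ^ 6) (2 * int M + (L - int m) div 2) (2 * int M))"
  proof (rule sum.reindex_bij_witness[of _ "\<lambda>m. (L - int m) div 2" "\<lambda>k. nat (L - 2 * k)"])
    fix k assume "k \<in> {k \<in> {0..N}. 2 * k \<le> L}"
    then have k: "k \<ge> 0" "2 * k \<le> L" by auto
    then have n: "int (nat (L - 2 * k)) = L - 2 * k" by simp
    have "q ^ (nat (L - 2 * k))\<^sup>2 = q powi (L - 2 * k)\<^sup>2"
      by (metis n of_nat_power power_int_of_nat)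
    moreover have "cube.gb (2 * int M + k) k = qbinom (q ^ 6) (2 * int M + k) (2 * int M)"
      using cube.gb_sym[of "2 * int M + k" k] cube.gb_eq_qbinom[of "2 * int M + k" "2 * int M"] k
      unfolding q6 by simp
    moreover have "gb (3 * int M) (L - 2 * k) = qbinom (q ^ 2) (3 * int M) (L - 2 * k)"
      by (simp add: gb_eq_qbinom)
    ultimately show "q ^ (nat (L - 2 * k))\<^sup>2 * qbinom (q ^ 2) (3 * int M) (int (nat (L - 2 * k)))
      * qbinom (q ^ 6) (2 * int M + (L - int (nat (L - 2 * k))) div 2) (2 * int M)
      = cube.gb (2 * int M + k) k * (q powi (L - 2 * k)\<^sup>2 * gb (3 * int M) (L - 2 * k))"
      unfolding n by simp
  qed (use assms in \<open>auto simp: even_nat_iff\<close>)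
  also have "\<dots> = seed N L M"
    unfolding seed_def
  proof (rule sum.mono_neutral_left)
    have "{m. int m \<le> N \<and> even (L + int m)} \<subseteq> {..nat N}" by auto
    then show "finite {m. int m \<le> N \<and> even (L + int m)}" by (rule finite_subset) simp
  next
    show "\<forall>m\<in>{m. int m \<le> N \<and> even (L + int m)} - {m. int m \<le> N \<and> even (L + int m) \<and> int m \<le> L}.
       q ^ m\<^sup>2 * qbinom (q ^ 2) (3 * int M) (int m) * qbinom (q ^ 6) (2 * int M + (L - int m) div 2) (2 * int M) = 0"
      by (auto simp: qbinom_def)
  qed auto
  finally show ?thesis ..
qed

end

subsection \<open>The multiple sum\<close>

text \<open>The tuples \<open>(N\<^sub>1, \<dots>, N\<^sub>\<nu>)\<close>; \<open>chain_diff\<close> recovers \<open>n\<^sub>k = N\<^sub>k - N\<^sub>k\<^sub>+\<^sub>1\<close> with \<open>N\<^sub>\<nu>\<^sub>+\<^sub>1 = 0\<close>.\<close>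

definition chains :: "nat \<Rightarrow> nat \<Rightarrow> (nat \<Rightarrow> nat) set" where
  "chains \<nu> L = {N \<in> {1..\<nu>} \<rightarrow>\<^sub>E {..L}. \<forall>k\<in>{1..<\<nu>}. N (Suc k) \<le> N k}"

definition chain_diff :: "nat \<Rightarrow> (nat \<Rightarrow> nat) \<Rightarrow> nat \<Rightarrow> nat" where
  "chain_diff \<nu> N = (\<lambda>k\<in>{1..\<nu>}. if k = \<nu> then N k else N k - N (Suc k))"

lemma finite_chains: "finite (chains \<nu> L)"
  by (rule finite_subset[of _ "{1..\<nu>} \<rightarrow>\<^sub>E {..L}"]) (auto simp: chains_def intro!: finite_PiE)

section \<open>From a tuple to its partial sums and back\<close>

lemma tail_sum_rec: "k \<le> \<nu> \<Longrightarrow> tail_sum \<nu> n k = n k + tail_sum \<nu> n (Suc k)"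
  unfolding tail_sum_def by (rule sum.atLeast_Suc_atMost)

lemma tail_sum_chain_diff:
  assumes "N \<in> chains \<nu> L" "1 \<le> k" "k \<le> \<nu>"
  shows "tail_sum \<nu> (chain_diff \<nu> N) k = N k"
  using assms(3,2)
proof (induction k rule: inc_induct)
  case base
  then show ?case by (simp add: tail_sum_def chain_diff_def)
next
  case (step k)
  then have "N (Suc k) \<le> N k" using assms(1) by (simp add: chains_def)
  then show ?case using step by (simp add: tail_sum_rec chain_diff_def)
qed

lemma chain_diff_tail_sum:
  assumes "n \<in> {1..\<nu>} \<rightarrow>\<^sub>E UNIV"
  shows "chain_diff \<nu> (restrict (tail_sum \<nu> n) {1..\<nu>}) = n"
proof
  fix k
  show "chain_diff \<nu> (restrict (tail_sum \<nu> n) {1..\<nu>}) k = n k"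
  proof (cases "k \<in> {1..\<nu>}")
    case True
    then show ?thesis
      by (cases "k = \<nu>") (auto simp: chain_diff_def tail_sum_rec, simp add: tail_sum_def)
  next
    case False
    then show ?thesis using assms by (auto simp: chain_diff_def PiE_def extensional_def)
  qed
qed

text \<open>Chains are extended at their smallest entry, which belongs to the innermost Burge
  step.\<close>

lemma sum_chains_Suc:
  assumes "\<nu> \<ge> 1"
  shows "(\<Sum>N\<in>chains (Suc \<nu>) L. f N) = (\<Sum>N\<in>chains \<nu> L. \<Sum>x\<le>N \<nu>. f (N(Suc \<nu> := x)))"
proof -
  have "(\<Sum>N\<in>chains \<nu> L. \<Sum>x\<le>N \<nu>. f (N(Suc \<nu> := x)))
      = (\<Sum>(N, x)\<in>Sigma (chains \<nu> L) (\<lambda>N. {..N \<nu>}). f (N(Suc \<nu> := x)))"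
    by (rule sum.Sigma) (auto simp: finite_chains)
  also have "\<dots> = (\<Sum>N\<in>chains (Suc \<nu>) L. f N)"
  proof (rule sum.reindex_bij_witness[of _ "\<lambda>N. (restrict N {1..\<nu>}, N (Suc \<nu>))" "\<lambda>(N, x). N(Suc \<nu> := x)"], goal_cases)
    case (1 p)
    obtain N x where p: "p = (N, x)" by fastforce
    have "restrict (N(Suc \<nu> := x)) {1..\<nu>} = N"
      using 1 by (auto simp: p chains_def PiE_def extensional_def restrict_def)
    then show ?case by (simp add: p)
  next
    case (2 p)
    obtain N x where p: "p = (N, x)" by fastforce
    have N: "N \<in> {1..\<nu>} \<rightarrow>\<^sub>E {..L}" "\<forall>k\<in>{1..<\<nu>}. N (Suc k) \<le> N k" "x \<le> N \<nu>"
      using 2 by (auto simp: p chains_def)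
    have "N \<nu> \<le> L" using N(1) assms by auto
    then have "N(Suc \<nu> := x) \<in> insert (Suc \<nu>) {1..\<nu>} \<rightarrow>\<^sub>E {..L}"
      using N by (intro PiE_fun_upd) auto
    moreover have "insert (Suc \<nu>) {1..\<nu>} = {1..Suc \<nu>}" by auto
    moreover have "(N(Suc \<nu> := x)) (Suc k) \<le> (N(Suc \<nu> := x)) k" if "k \<in> {1..<Suc \<nu>}" for k
      using N that by (cases "k = \<nu>") auto
    ultimately show ?case by (simp add: p chains_def)
  next
    case (3 N)
    show ?case
      using 3 by (auto simp: chains_def PiE_def extensional_def restrict_def fun_eq_iff le_Suc_eq)
  next
    case (4 N)
    then have "restrict N {1..\<nu>} \<in> chains \<nu> L"
      by (auto simp: chains_def PiE_iff)
    moreover have "N (Suc \<nu>) \<le> N \<nu>" using 4 assms by (auto simp: chains_def)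
    ultimately show ?case using assms by simp
  next
    case (5 p)
    then show ?case by auto
  qed
  finally show ?thesis ..
qed

section \<open>Iterated Burge steps\<close>

context capparelli
begin

definition burge :: "(int \<Rightarrow> nat \<Rightarrow> complex) \<Rightarrow> int \<Rightarrow> nat \<Rightarrow> complex" where
  "burge f L M = (\<Sum>x\<le>M. q ^ (3 * x\<^sup>2) * qbinom (q ^ 6) (L + int M - int x) (int M - int x) * f (L - int x) x)"

text \<open>The step of N_1 is outermost and carries no q-binomial coefficient, being the limit of a
  Burge step; the product over j < \<nu> supplies those of N_2, ..., N_\<nu>.\<close>

definition chain_sum :: "nat \<Rightarrow> nat \<Rightarrow> (int \<Rightarrow> nat \<Rightarrow> complex) \<Rightarrow> complex" where
  "chain_sum \<nu> L f = (\<Sum>N\<in>chains \<nu> L. q ^ (3 * (\<Sum>k=1..\<nu>. (N k)\<^sup>2))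
     * (\<Prod>j=1..<\<nu>. qbinom (q ^ 6) (int L - int (\<Sum>l=1..j. N l) + (int (N j) - int (N (Suc j)))) (int (N j) - int (N (Suc j))))
     * f (int L - int (\<Sum>k=1..\<nu>. N k)) (N \<nu>))"

lemma chain_sum_1: "chain_sum (Suc 0) L f = (\<Sum>x\<le>L. q ^ (3 * x\<^sup>2) * f (int L - int x) x)"
  unfolding chain_sum_def
proof (rule sum.reindex_bij_witness[of _ "\<lambda>x. \<lambda>k\<in>{1}. x" "\<lambda>N. N 1"], goal_cases)
  case (1 N)
  then show ?case by (auto simp: chains_def PiE_def extensional_def restrict_def fun_eq_iff)
qed (auto simp: chains_def)

text \<open>The new factor of the product is the weight of a Burge step at (L - N_1 - ... - N_\<nu>,
  N_\<nu>) with summation index x, so the innermost step can be absorbed into f.\<close>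

lemma chain_sum_Suc:
  assumes "\<nu> \<ge> 1"
  shows "chain_sum (Suc \<nu>) L f = chain_sum \<nu> L (burge f)"
proof -
  show ?thesis
    unfolding chain_sum_def sum_chains_Suc[OF assms]
  proof (rule sum.cong[OF refl])
    fix N
    let ?b = "\<lambda>N j. qbinom (q ^ 6) (int L - int (\<Sum>l=1..j. N l) + (int (N j) - int (N (Suc j)))) (int (N j) - int (N (Suc j)))"
    have "q ^ (3 * (\<Sum>k=1..Suc \<nu>. ((N(Suc \<nu> := x)) k)\<^sup>2)) * (\<Prod>j=1..<Suc \<nu>. ?b (N(Suc \<nu> := x)) j)
         * f (int L - int (\<Sum>k=1..Suc \<nu>. (N(Suc \<nu> := x)) k)) ((N(Suc \<nu> := x)) (Suc \<nu>))
       = q ^ (3 * (\<Sum>k=1..\<nu>. (N k)\<^sup>2)) * (\<Prod>j=1..<\<nu>. ?b N j) *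
        (q ^ (3 * x\<^sup>2) * qbinom (q ^ 6) (int L - int (\<Sum>k=1..\<nu>. N k) + int (N \<nu>) - int x) (int (N \<nu>) - int x)
          * f (int L - int (\<Sum>k=1..\<nu>. N k) - int x) x)" for x
    proof -
      have s: "(\<Sum>k=1..j. (N(Suc \<nu> := x)) k) = (\<Sum>k=1..j. N k)" if "j \<le> \<nu>" for j
        using that by (intro sum.cong) auto
      have s2: "(\<Sum>k=1..\<nu>. ((N(Suc \<nu> := x)) k)\<^sup>2) = (\<Sum>k=1..\<nu>. (N k)\<^sup>2)"
        by (intro sum.cong) auto
      have p: "(\<Prod>j=1..<\<nu>. ?b (N(Suc \<nu> := x)) j) = (\<Prod>j=1..<\<nu>. ?b N j)"
      proof (rule prod.cong[OF refl])
        fix j assume "j \<in> {1..<\<nu>}"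
        then have "j \<le> \<nu>" "(N(Suc \<nu> := x)) j = N j" "(N(Suc \<nu> := x)) (Suc j) = N (Suc j)" by auto
        then show "?b (N(Suc \<nu> := x)) j = ?b N j" using s[of j] by (simp only:)
      qed
      have b: "?b (N(Suc \<nu> := x)) \<nu> = qbinom (q ^ 6) (int L - int (\<Sum>k=1..\<nu>. N k) + int (N \<nu>) - int x) (int (N \<nu>) - int x)"
        unfolding s[OF order_refl] by (simp add: add_diff_eq)
      have "(\<Prod>j=1..<Suc \<nu>. ?b (N(Suc \<nu> := x)) j) = (\<Prod>j=1..<\<nu>. ?b (N(Suc \<nu> := x)) j) * ?b (N(Suc \<nu> := x)) \<nu>"
        using assms by (rule prod.atLeastLessThan_Suc)
      then have P: "(\<Prod>j=1..<Suc \<nu>. ?b (N(Suc \<nu> := x)) j) = (\<Prod>j=1..<\<nu>. ?b N j) *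
           qbinom (q ^ 6) (int L - int (\<Sum>k=1..\<nu>. N k) + int (N \<nu>) - int x) (int (N \<nu>) - int x)"
        unfolding p b .
      have S: "(\<Sum>k=1..Suc \<nu>. (N(Suc \<nu> := x)) k) = (\<Sum>k=1..\<nu>. N k) + x"
        using s[of \<nu>] by simp
      have S2: "(\<Sum>k=1..Suc \<nu>. ((N(Suc \<nu> := x)) k)\<^sup>2) = (\<Sum>k=1..\<nu>. (N k)\<^sup>2) + x\<^sup>2"
        using s2 by simp
      have f: "f (int L - int ((\<Sum>k=1..\<nu>. N k) + x)) ((N(Suc \<nu> := x)) (Suc \<nu>)) = f (int L - int (\<Sum>k=1..\<nu>. N k) - int x) x"
        by (simp add: diff_diff_eq)
      show ?thesis unfolding P S S2 f by (simp only: distrib_left power_add mult_ac)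
    qed
    then show "(\<Sum>x\<le>N \<nu>. q ^ (3 * (\<Sum>k=1..Suc \<nu>. ((N(Suc \<nu> := x)) k)\<^sup>2)) * (\<Prod>j=1..<Suc \<nu>. ?b (N(Suc \<nu> := x)) j)
         * f (int L - int (\<Sum>k=1..Suc \<nu>. (N(Suc \<nu> := x)) k)) ((N(Suc \<nu> := x)) (Suc \<nu>)))
       = q ^ (3 * (\<Sum>k=1..\<nu>. (N k)\<^sup>2)) * (\<Prod>j=1..<\<nu>. ?b N j) * burge f (int L - int (\<Sum>k=1..\<nu>. N k)) (N \<nu>)"
      unfolding burge_def sum_distrib_left by (simp only:)
  qed
qed

lemma cube_base: "(q ^ 3)\<^sup>2 = q ^ 6"
  by (simp flip: power_mult)

lemma cube_powi: "(q ^ 3) powi (int x)\<^sup>2 = q ^ (3 * x\<^sup>2)"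
  by (metis of_nat_power power_int_of_nat power_mult)

text \<open>\<open>burge\<close> uses \<open>qbinom\<close> and \<open>RT_burge\<close> uses
  \<open>gb\<close>. They agree for x \<le> L, where the top entry is nonnegative, and for x > L the
  factor \<open>cube.RT\<close> vanishes because a j \<ge> 0. The restriction to L \<le> K comes
  from \<open>seed_eq_RT\<close> and is preserved, as a step never raises L.\<close>

lemma burge_RT:
  assumes f: "\<And>L M. L \<le> K \<Longrightarrow> f L M = (\<Sum>j\<in>J. c j * cube.RT L (int M) (a j) (b j))"
    and nonneg: "\<And>j. j \<in> J \<Longrightarrow> a j \<ge> 0 \<and> b j \<ge> 0" and "L \<le> K"
  shows "burge f L M = (\<Sum>j\<in>J. c j * (q ^ 3) powi (b j)\<^sup>2 * cube.RT L (int M) (a j + b j) (b j))"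
proof -
  have "burge f L M = (\<Sum>x\<le>M. \<Sum>j\<in>J. c j * ((q ^ 3) powi (int x)\<^sup>2 * cube.gb (L + int M - int x) (int M - int x)
      * cube.RT (L - int x) (int x) (a j) (b j)))"
    unfolding burge_def
  proof (rule sum.cong[OF refl])
    fix x assume x: "x \<in> {..M}"
    have fx: "f (L - int x) x = (\<Sum>j\<in>J. c j * cube.RT (L - int x) (int x) (a j) (b j))"
      using \<open>L \<le> K\<close> by (intro f) auto
    show "q ^ (3 * x\<^sup>2) * qbinom (q ^ 6) (L + int M - int x) (int M - int x) * f (L - int x) x =
      (\<Sum>j\<in>J. c j * ((q ^ 3) powi (int x)\<^sup>2 * cube.gb (L + int M - int x) (int M - int x)
      * cube.RT (L - int x) (int x) (a j) (b j)))"
    proof (cases "L < int x")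
      case True
      then have "cube.RT (L - int x) (int x) (a j) (b j) = 0" if "j \<in> J" for j
        using nonneg[OF that] by (intro cube.RT_eq_0') auto
      then show ?thesis unfolding fx by simp
    next
      case False
      then have "cube.gb (L + int M - int x) (int M - int x) = qbinom (q ^ 6) (L + int M - int x) (int M - int x)"
        using cube.gb_eq_qbinom[of "L + int M - int x" "int M - int x"] by (simp add: cube_base)
      then show ?thesis unfolding fx cube_powi sum_distrib_left by (simp only: mult_ac)
    qed
  qed
  also have "\<dots> = (\<Sum>j\<in>J. c j * (\<Sum>x\<le>M. (q ^ 3) powi (int x)\<^sup>2 * cube.gb (L + int M - int x) (int M - int x)
      * cube.RT (L - int x) (int x) (a j) (b j)))"
    unfolding sum_distrib_left by (rule sum.swap)
  also have "\<dots> = (\<Sum>j\<in>J. c j * (q ^ 3) powi (b j)\<^sup>2 * cube.RT L (int M) (a j + b j) (b j))"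
  proof (rule sum.cong[OF refl])
    fix j assume "j \<in> J"
    have "(\<Sum>x\<le>M. (q ^ 3) powi (int x)\<^sup>2 * cube.gb (L + int M - int x) (int M - int x) * cube.RT (L - int x) (int x) (a j) (b j))
      = (\<Sum>i\<in>{0..int M}. (q ^ 3) powi i\<^sup>2 * cube.gb (L + int M - i) (int M - i) * cube.RT (L - i) i (a j) (b j))"
      by (rule sum.reindex_bij_witness[of _ nat int]) auto
    then show "c j * (\<Sum>x\<le>M. (q ^ 3) powi (int x)\<^sup>2 * cube.gb (L + int M - int x) (int M - int x)
      * cube.RT (L - int x) (int x) (a j) (b j)) = c j * (q ^ 3) powi (b j)\<^sup>2 * cube.RT L (int M) (a j + b j) (b j)"
      using cube.RT_burge[of "b j"] nonneg[OF \<open>j \<in> J\<close>] by simp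
  qed
  finally show ?thesis .
qed

text \<open>The innermost step is absorbed first, which changes f, c and a but not b; hence the
  generalization in the induction. The outermost step is the base case, by
  \<open>RT_burge_limit\<close>.\<close>

lemma chain_sum_RT:
  assumes "\<And>L' M. L' \<le> int L \<Longrightarrow> f L' M = (\<Sum>j\<in>J. c j * cube.RT L' (int M) (a j) (b j))"
    and "\<And>j. j \<in> J \<Longrightarrow> a j \<ge> 0 \<and> b j \<ge> 0"
  shows "chain_sum (Suc \<nu>) L f = (\<Sum>j\<in>J. c j * (q ^ 3) powi (int (Suc \<nu>) * (b j)\<^sup>2) * T0 L (a j + int (Suc \<nu>) * b j) (q ^ 3))"
  using assms
proof (induction \<nu> arbitrary: f c a)
  case 0
  have "chain_sum (Suc 0) L f = (\<Sum>x\<le>L. \<Sum>j\<in>J. c j * ((q ^ 3) powi (int x)\<^sup>2 * cube.RT (int L - int x) (int x) (a j) (b j)))"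
    unfolding chain_sum_1
    by (intro sum.cong refl) (simp add: 0(1) cube_powi sum_distrib_left mult_ac)
  also have "\<dots> = (\<Sum>j\<in>J. c j * (\<Sum>x\<le>L. (q ^ 3) powi (int x)\<^sup>2 * cube.RT (int L - int x) (int x) (a j) (b j)))"
    unfolding sum_distrib_left by (rule sum.swap)
  also have "\<dots> = (\<Sum>j\<in>J. c j * ((q ^ 3) powi (b j)\<^sup>2 * T0 L (a j + b j) (q ^ 3)))"
  proof (rule sum.cong[OF refl])
    fix j assume "j \<in> J"
    have "(\<Sum>x\<le>L. (q ^ 3) powi (int x)\<^sup>2 * cube.RT (int L - int x) (int x) (a j) (b j))
      = (\<Sum>i\<in>{0..int L}. (q ^ 3) powi i\<^sup>2 * cube.RT (int L - i) i (a j) (b j))"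
      by (rule sum.reindex_bij_witness[of _ nat int]) auto
    then show "c j * (\<Sum>x\<le>L. (q ^ 3) powi (int x)\<^sup>2 * cube.RT (int L - int x) (int x) (a j) (b j))
      = c j * ((q ^ 3) powi (b j)\<^sup>2 * T0 L (a j + b j) (q ^ 3))"
      using cube.RT_burge_limit[of "a j" "b j" L] 0(2)[OF \<open>j \<in> J\<close>] by simp
  qed
  finally show ?case by (simp add: mult.assoc)
next
  case (Suc \<nu>)
  have "chain_sum (Suc (Suc \<nu>)) L f = chain_sum (Suc \<nu>) L (burge f)"
    by (rule chain_sum_Suc) simp
  also have "\<dots> = (\<Sum>j\<in>J. (c j * (q ^ 3) powi (b j)\<^sup>2) * (q ^ 3) powi (int (Suc \<nu>) * (b j)\<^sup>2) * T0 L ((a j + b j) + int (Suc \<nu>) * b j) (q ^ 3))"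
  proof (rule Suc.IH)
    show "burge f L' M = (\<Sum>j\<in>J. c j * (q ^ 3) powi (b j)\<^sup>2 * cube.RT L' (int M) (a j + b j) (b j))"
      if "L' \<le> int L" for L' M
      using Suc.prems that by (rule burge_RT)
    show "a j + b j \<ge> 0 \<and> b j \<ge> 0" if "j \<in> J" for j
      using Suc.prems(2)[OF that] by auto
  qed
  also have "\<dots> = (\<Sum>j\<in>J. c j * (q ^ 3) powi (int (Suc (Suc \<nu>)) * (b j)\<^sup>2) * T0 L (a j + int (Suc (Suc \<nu>)) * b j) (q ^ 3))"
  proof (rule sum.cong[OF refl])
    fix j
    have "int (Suc (Suc \<nu>)) * (b j)\<^sup>2 = (b j)\<^sup>2 + int (Suc \<nu>) * (b j)\<^sup>2" by (simp add: algebra_simps)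
    then have 1: "(q ^ 3) powi (int (Suc (Suc \<nu>)) * (b j)\<^sup>2) = (q ^ 3) powi (b j)\<^sup>2 * (q ^ 3) powi (int (Suc \<nu>) * (b j)\<^sup>2)"
      by (simp only: power_int_add[OF disjI1[OF cube.s_nz]])
    have 2: "a j + int (Suc (Suc \<nu>)) * b j = (a j + b j) + int (Suc \<nu>) * b j" by (simp add: algebra_simps)
    show "(c j * (q ^ 3) powi (b j)\<^sup>2) * (q ^ 3) powi (int (Suc \<nu>) * (b j)\<^sup>2) * T0 L ((a j + b j) + int (Suc \<nu>) * b j) (q ^ 3)
       = c j * (q ^ 3) powi (int (Suc (Suc \<nu>)) * (b j)\<^sup>2) * T0 L (a j + int (Suc (Suc \<nu>)) * b j) (q ^ 3)"
      unfolding 1 2 by (simp only: mult.assoc)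
  qed
  finally show ?case .
qed

lemma multisum_eq_chain_sum:
  assumes "\<nu> \<ge> 1"
  shows "(\<Sum>\<^sub>\<infinity>(m, n)\<in>sum_index \<nu> L.
           q ^ (m\<^sup>2 + 3 * (\<Sum>k=1..\<nu>. (tail_sum \<nu> n k)\<^sup>2))
           * qbinom (q ^ 2) (3 * int (n \<nu>)) (int m)
           * qbinom (q ^ 6)
               (2 * int (n \<nu>) + (int L - int m - int (\<Sum>k=1..\<nu>. tail_sum \<nu> n k)) div 2)
               (2 * int (n \<nu>))
           * (\<Prod>j=1..<\<nu>.
               qbinom (q ^ 6)
                 (int L - int (\<Sum>l=1..j. tail_sum \<nu> n l) + int (n j))
                 (int (n j)))) = chain_sum \<nu> L (seed (int L))"
    (is "infsum ?F _ = _")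
proof -
  define T where "T = (\<lambda>n. restrict (tail_sum \<nu> n) {1..\<nu>})"
  define X where "X = (\<lambda>N. \<Sum>k=1..\<nu>. (N k :: nat))"
  define ms where "ms = (\<lambda>N. {m. int m \<le> int L \<and> even (int L - int (X N) + int m)})"
  define B where "B = {(m, n) \<in> sum_index \<nu> L. m \<le> L \<and> (\<forall>k\<in>{1..\<nu>}. tail_sum \<nu> n k \<le> L)}"
  define G where "G = (\<lambda>(N, m). q ^ (3 * (\<Sum>k=1..\<nu>. (N k)\<^sup>2))
     * (\<Prod>j=1..<\<nu>. qbinom (q ^ 6) (int L - int (\<Sum>l=1..j. N l) + (int (N j) - int (N (Suc j)))) (int (N j) - int (N (Suc j))))
     * (q ^ m\<^sup>2 * qbinom (q ^ 2) (3 * int (N \<nu>)) (int m)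
      * qbinom (q ^ 6) (2 * int (N \<nu>) + (int L - int (X N) - int m) div 2) (2 * int (N \<nu>))))"
  have XT: "X (T n) = (\<Sum>k=1..\<nu>. tail_sum \<nu> n k)" for n
    unfolding X_def T_def by (intro sum.cong) auto
  have parity: "[L + m = x] (mod 2) \<longleftrightarrow> even (int L - int x + int m)" for m x
    unfolding cong_def by presburger
  have fin_ms: "finite (ms N)" for N
    by (rule finite_subset[of _ "{..L}"]) (auto simp: ms_def)
  have T_chain: "T n \<in> chains \<nu> L" if "\<forall>k\<in>{1..\<nu>}. tail_sum \<nu> n k \<le> L" for n
    using that by (auto simp: T_def chains_def tail_sum_rec)
  have T_inv: "chain_diff \<nu> N \<in> {1..\<nu>} \<rightarrow>\<^sub>E UNIV \<and> T (chain_diff \<nu> N) = N"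
    if "N \<in> chains \<nu> L" for N
  proof
    show "chain_diff \<nu> N \<in> {1..\<nu>} \<rightarrow>\<^sub>E UNIV" by (simp add: chain_diff_def)
    show "T (chain_diff \<nu> N) = N"
      using tail_sum_chain_diff[OF that] that
      by (auto simp: T_def fun_eq_iff chains_def PiE_def extensional_def restrict_def)
  qed
  \<comment> \<open>Outside B, m or some N_k exceeds L. Then L - m - N_1 - ... - N_\<nu> is
    negative, so is its half rounded down, and the coefficient with lower entry 2 n_\<nu> is
    0.\<close>
  have "infsum ?F (sum_index \<nu> L) = infsum ?F B"
  proof (rule infsum_cong_neutral)
    fix p assume p: "p \<in> sum_index \<nu> L - B"
    obtain m n where mn: "p = (m, n)" by fastforce
    show "?F p = 0"
    proof (rule ccontr)
      assume "?F p \<noteq> 0"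
      then have "qbinom (q ^ 6) (2 * int (n \<nu>) + (int L - int m - int (\<Sum>k=1..\<nu>. tail_sum \<nu> n k)) div 2)
               (2 * int (n \<nu>)) \<noteq> 0"
        by (auto simp: mn)
      then have "0 \<le> (int L - int m - int (\<Sum>k=1..\<nu>. tail_sum \<nu> n k)) div 2"
        unfolding qbinom_def by (metis add_diff_cancel_left')
      then have le: "m + (\<Sum>k=1..\<nu>. tail_sum \<nu> n k) \<le> L" by linarith
      moreover have "tail_sum \<nu> n k \<le> (\<Sum>k=1..\<nu>. tail_sum \<nu> n k)" if "k \<in> {1..\<nu>}" for k
        using that by (intro member_le_sum) auto
      ultimately have "m \<le> L \<and> (\<forall>k\<in>{1..\<nu>}. tail_sum \<nu> n k \<le> L)"
        by (meson add_leD1 add_leD2 le_trans)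
      then show False using p by (simp add: B_def mn)
    qed
  qed (auto simp: B_def)
  also have "\<dots> = sum ?F B"
  proof (rule infsum_finite)
    have "B \<subseteq> {..L} \<times> (chain_diff \<nu> ` chains \<nu> L)"
    proof
      fix p assume "p \<in> B"
      then obtain m n where mn: "p = (m, n)" "(m, n) \<in> sum_index \<nu> L" "m \<le> L" "\<forall>k\<in>{1..\<nu>}. tail_sum \<nu> n k \<le> L"
        by (auto simp: B_def)
      then have "n = chain_diff \<nu> (T n)"
        unfolding T_def by (subst chain_diff_tail_sum) (auto simp: sum_index_def)
      then show "p \<in> {..L} \<times> (chain_diff \<nu> ` chains \<nu> L)"
        using mn T_chain[of n] by auto
    qed
    then show "finite B" by (rule finite_subset) (auto simp: finite_chains)
  qed
  also have "\<dots> = sum G (Sigma (chains \<nu> L) ms)"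
  proof (rule sum.reindex_bij_witness[of _ "\<lambda>(N, m). (m, chain_diff \<nu> N)" "\<lambda>(m, n). (T n, m)"], goal_cases)
    case (1 p)
    then show ?case
      by (auto simp: B_def T_def sum_index_def chain_diff_tail_sum[unfolded One_nat_def])
  next
    case (2 p)
    then obtain m n where mn: "p = (m, n)" "(m, n) \<in> sum_index \<nu> L" "m \<le> L" "\<forall>k\<in>{1..\<nu>}. tail_sum \<nu> n k \<le> L"
      by (auto simp: B_def)
    then have "even (int L - int (X (T n)) + int m)"
      unfolding XT parity[symmetric] by (simp add: sum_index_def)
    then show ?case using T_chain[OF mn(4)] mn by (simp add: ms_def)
  next
    case (3 p)
    then show ?case using T_inv by auto
  next
    case (4 p)
    then obtain N m where p: "p = (N, m)" "N \<in> chains \<nu> L" "m \<in> ms N" by auto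
    let ?n = "chain_diff \<nu> N"
    have "X N = (\<Sum>k=1..\<nu>. tail_sum \<nu> ?n k)"
      using XT[of ?n] T_inv[OF p(2)] by simp
    then have "[L + m = (\<Sum>k=1..\<nu>. tail_sum \<nu> ?n k)] (mod 2)"
      using p(3) unfolding parity ms_def by (simp only: mem_Collect_eq)
    moreover have "\<forall>k\<in>{1..\<nu>}. tail_sum \<nu> ?n k \<le> L"
      using tail_sum_chain_diff[OF p(2)] p(2) by (auto simp: chains_def)
    moreover have "m \<le> L" using p(3) by (simp add: ms_def)
    ultimately show ?case using T_inv[OF p(2)] by (simp add: p B_def sum_index_def)
  next
    case (5 p)
    then obtain m n where mn: "p = (m, n)" "(m, n) \<in> sum_index \<nu> L" "m \<le> L" "\<forall>k\<in>{1..\<nu>}. tail_sum \<nu> n k \<le> L"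
      by (auto simp: B_def)
    have Tk: "T n k = tail_sum \<nu> n k" if "1 \<le> k" "k \<le> \<nu>" for k
      using that by (simp add: T_def)
    have n\<nu>: "T n \<nu> = n \<nu>" using assms by (simp add: Tk tail_sum_def)
    have sq: "(\<Sum>k=1..\<nu>. (T n k)\<^sup>2) = (\<Sum>k=1..\<nu>. (tail_sum \<nu> n k)\<^sup>2)"
      by (intro sum.cong) (auto simp: Tk)
    have pr: "(\<Prod>j=1..<\<nu>. qbinom (q ^ 6) (int L - int (\<Sum>l=1..j. T n l) + (int (T n j) - int (T n (Suc j)))) (int (T n j) - int (T n (Suc j))))
      = (\<Prod>j=1..<\<nu>. qbinom (q ^ 6) (int L - int (\<Sum>l=1..j. tail_sum \<nu> n l) + int (n j)) (int (n j)))"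
    proof (rule prod.cong[OF refl])
      fix j assume j: "j \<in> {1..<\<nu>}"
      have "int (T n j) - int (T n (Suc j)) = int (n j)"
        using j by (simp add: Tk tail_sum_rec)
      moreover have "(\<Sum>l=1..j. T n l) = (\<Sum>l=1..j. tail_sum \<nu> n l)"
        using j by (intro sum.cong) (auto simp: Tk)
      ultimately show "qbinom (q ^ 6) (int L - int (\<Sum>l=1..j. T n l) + (int (T n j) - int (T n (Suc j)))) (int (T n j) - int (T n (Suc j)))
        = qbinom (q ^ 6) (int L - int (\<Sum>l=1..j. tail_sum \<nu> n l) + int (n j)) (int (n j))"
        by (simp only:)
    qed
    have d: "int L - int x - int m = int L - int m - int x" for x by simp
    show ?case
      unfolding mn(1) G_def prod.case XT n\<nu> sq pr d power_add by (simp only: mult_ac)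
  qed
  also have "\<dots> = (\<Sum>N\<in>chains \<nu> L. \<Sum>m\<in>ms N. G (N, m))"
    by (subst sum.Sigma) (auto simp: finite_chains fin_ms)
  also have "\<dots> = chain_sum \<nu> L (seed (int L))"
    unfolding chain_sum_def seed_def sum_distrib_left G_def ms_def X_def prod.case by (rule refl)
  finally show ?thesis .
qed

end

theorem theorem5p4:
  fixes q :: complex and \<nu> L :: nat
  assumes "q \<noteq> 0" and "norm q < 1" and "\<nu> \<ge> 1"
  shows "(\<Sum>\<^sub>\<infinity>(m, n)\<in>sum_index \<nu> L.
           q ^ (m\<^sup>2 + 3 * (\<Sum>k=1..\<nu>. (tail_sum \<nu> n k)\<^sup>2))
           * qbinom (q ^ 2) (3 * int (n \<nu>)) (int m)
           * qbinom (q ^ 6)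
               (2 * int (n \<nu>) + (int L - int m - int (\<Sum>k=1..\<nu>. tail_sum \<nu> n k)) div 2)
               (2 * int (n \<nu>))
           * (\<Prod>j=1..<\<nu>.
               qbinom (q ^ 6)
                 (int L - int (\<Sum>l=1..j. tail_sum \<nu> n l) + int (n j))
                 (int (n j))))
       = (\<Sum>\<^sub>\<infinity>j::int. q powi (3 * (int \<nu> + 1) * j\<^sup>2 + 2 * j)
           * T0 L ((int \<nu> + 1) * j) (q ^ 3))"
proof -
  interpret capparelli q
    by unfold_locales (use assms in auto)
  obtain \<mu> where \<mu>: "\<nu> = Suc \<mu>" using assms(3) by (cases \<nu>) auto
  let ?J = "{- int L..int L}"
  let ?f = "\<lambda>j. q powi (3 * (int \<nu> + 1) * j\<^sup>2 + 2 * j) * T0 L ((int \<nu> + 1) * j) (q ^ 3)"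
  \<comment> \<open>Both parameters are |j| here. The absolute value left inside \<open>T0\<close>
    at the end is removed by \<open>T0_abs\<close>.\<close>
  have "chain_sum \<nu> L (seed (int L)) = (\<Sum>j\<in>?J. q powi (3 * j\<^sup>2 + 2 * j) * (q ^ 3) powi (int \<nu> * \<bar>j\<bar>\<^sup>2)
      * T0 L (\<bar>j\<bar> + int \<nu> * \<bar>j\<bar>) (q ^ 3))"
    unfolding \<mu> by (rule chain_sum_RT) (auto intro: seed_eq_RT)
  also have "\<dots> = sum ?f ?J"
  proof (rule sum.cong[OF refl])
    fix j
    have "(q ^ 3) powi (int \<nu> * \<bar>j\<bar>\<^sup>2) = q powi (3 * (int \<nu> * j\<^sup>2))"
      by (simp add: power_int_mult)
    then have "q powi (3 * j\<^sup>2 + 2 * j) * (q ^ 3) powi (int \<nu> * \<bar>j\<bar>\<^sup>2) = q powi (3 * (int \<nu> + 1) * j\<^sup>2 + 2 * j)"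
      using s_nz by (simp add: algebra_simps flip: power_int_add)
    moreover have "\<bar>j\<bar> + int \<nu> * \<bar>j\<bar> = \<bar>(int \<nu> + 1) * j\<bar>"
    proof -
      have "\<bar>(int \<nu> + 1) * j\<bar> = (int \<nu> + 1) * \<bar>j\<bar>" by (simp add: abs_mult)
      then show ?thesis by (simp add: distrib_right)
    qed
    ultimately show "q powi (3 * j\<^sup>2 + 2 * j) * (q ^ 3) powi (int \<nu> * \<bar>j\<bar>\<^sup>2) * T0 L (\<bar>j\<bar> + int \<nu> * \<bar>j\<bar>) (q ^ 3) = ?f j"
      by (simp only: T0_abs)
  qed
  also have "\<dots> = infsum ?f ?J" by simp
  also have "\<dots> = infsum ?f UNIV"
  proof (rule infsum_cong_neutral)
    fix j assume "j \<in> UNIV - ?J"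
    then have "int L < 1 * \<bar>j\<bar>" by auto
    also have "\<dots> \<le> \<bar>(int \<nu> + 1) * j\<bar>"
      unfolding abs_mult by (intro mult_right_mono) auto
    finally show "?f j = 0" by (simp add: T0_eq_0)
  qed auto
  finally show ?thesis
    unfolding multisum_eq_chain_sum[OF assms(3)] .
qed

end
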